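(* Let $G$ be a finite simple graph with vertex set $[n]=\{1,\ldots,n\}$, let $I(G)\subset K[x_1,\ldots,x_n]$ be its edge ideal, and let $c=\dim \Delta(G)$ be the dimension of the complex $\Delta(G)$ of stable sets of $G$. Then $$\operatorname{reg} I(G)^s\leq 2s+c \quad\text{for all integers } s\geq 1.$$
   Context: $K$ is a field and $S=K[x_1,\ldots,x_n]$ is the polynomial ring with the standard grading. For a finite simple graph $G$ on the vertex set $[n]$, the edge ideal is $I(G)=(x_ix_j : \{i,j\}\text{ is an edge of }G)\subset S$. A subset $T\subseteq V(G)$ is called stable (or independent) if no $2$-element subset of $T$ is an edge of $G$. The stable sets of $G$ form a simplicial complex $\Delta(G)$, the stable complex of $G$; its dimension is $\max\{|T| : T \text{ stable}\}-1$. For a graded ideal $I$, $\operatorname{reg} I$ denotes the Castelnuovo–Mumford regularity of $I$ as a graded $S$-module, and $I^s$ is the $s$-th ordinary power. *)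

theory Defs
  imports
    "Jordan_Normal_Form.Matrix_Kernel"
    "HOL-Library.Poly_Mapping"
    "HOL-Library.Extended_Real"
begin

subsection \<open>The polynomial ring and its ideals\<close>

text \<open>
  The variables are indexed by a finite type \<open>'n\<close>, so the whole type \<open>('n, 'k) mpoly\<close> is the
  polynomial ring in \<open>CARD('n)\<close> variables; monomials are exponent vectors.
\<close>

type_synonym 'n monomial = "'n \<Rightarrow>\<^sub>0 nat"
type_synonym ('n, 'k) mpoly = "'n monomial \<Rightarrow>\<^sub>0 'k"

definition X :: "'n \<Rightarrow> ('n, 'k::comm_ring_1) mpoly" where
  "X v = Poly_Mapping.single (Poly_Mapping.single v 1) 1"

definition monomial_degree :: "'n::finite monomial \<Rightarrow> nat" where
  "monomial_degree m = (\<Sum>v\<in>UNIV. Poly_Mapping.lookup m v)"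

text \<open>The zero polynomial is homogeneous of every degree, including the negative ones.\<close>

definition homogeneous :: "int \<Rightarrow> ('n::finite, 'k::zero) mpoly \<Rightarrow> bool" where
  "homogeneous e p \<longleftrightarrow> (\<forall>m\<in>Poly_Mapping.keys p. int (monomial_degree m) = e)"

definition ideal_gen :: "'a::comm_ring_1 set \<Rightarrow> 'a set" where
  "ideal_gen B = Modules.module.span (*) B"

lemma module_times: "Modules.module ((*) :: 'a::comm_ring_1 \<Rightarrow> 'a \<Rightarrow> 'a)"
  by (rule Modules.module.intro) (simp_all add: algebra_simps)

primrec ideal_power :: "'a::comm_ring_1 set \<Rightarrow> nat \<Rightarrow> 'a set" where
  "ideal_power I 0 = UNIV"
| "ideal_power I (Suc s) = ideal_gen {f * g | f g. f \<in> I \<and> g \<in> ideal_power I s}"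

definition graded_maximal_ideal :: "('n, 'k::comm_ring_1) mpoly set" where
  "graded_maximal_ideal = ideal_gen (range X)"


subsection \<open>Minimal graded free resolutions and regularity\<close>

text \<open>
  A list \<open>d\<close> of integers stands for the graded free module with one summand \<open>S(-d!k)\<close> for each
  \<open>k < length d\<close>, that is, with a basis whose \<open>k\<close>-th element has degree \<open>d!k\<close>. A homogeneous
  homomorphism of degree 0 from the module with degrees \<open>d'\<close> to the module with degrees \<open>d\<close> is
  given by a matrix acting on column vectors.
\<close>

definition graded_matrix :: "int list \<Rightarrow> int list \<Rightarrow> ('n::finite, 'k::comm_ring_1) mpoly mat \<Rightarrow> bool" where
  "graded_matrix d d' A \<longleftrightarrow> A \<in> carrier_mat (length d) (length d') \<and>
     (\<forall>k < length d. \<forall>l < length d'. homogeneous (d'!l - d!k) (A $$ (k, l)))"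

definition mat_image :: "'a::comm_ring_1 mat \<Rightarrow> 'a vec set" where
  "mat_image A = (\<lambda>v. A *\<^sub>v v) ` carrier_vec (dim_col A)"

text \<open>
  A minimal graded free resolution \<open>\<dots> \<rightarrow> F 1 \<rightarrow> F 0 \<rightarrow> I \<rightarrow> 0\<close> of a graded ideal \<open>I\<close>, where \<open>d i\<close>
  lists the degrees of the basis of \<open>F i\<close>. The augmentation \<open>F 0 \<rightarrow> I\<close>, composed with the
  inclusion of \<open>I\<close> into \<open>S\<close>, is the one-row matrix \<open>\<phi> 0\<close>, and \<open>\<phi> (Suc i)\<close> is the
  differential \<open>F (Suc i) \<rightarrow> F i\<close>. Minimality is a condition on the differentials only, not on the
  augmentation.
\<close>

definition minimal_graded_free_resolution ::
  "('n::finite, 'k::field) mpoly set \<Rightarrow> (nat \<Rightarrow> int list) \<Rightarrow> (nat \<Rightarrow> ('n, 'k) mpoly mat) \<Rightarrow> bool" where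
  "minimal_graded_free_resolution I d \<phi> \<longleftrightarrow>
     graded_matrix [0] (d 0) (\<phi> 0) \<and>
     (\<forall>i. graded_matrix (d i) (d (Suc i)) (\<phi> (Suc i))) \<and>
     mat_image (\<phi> 0) = {vec 1 (\<lambda>_. f) | f. f \<in> I} \<and>
     (\<forall>i. mat_image (\<phi> (Suc i)) = mat_kernel (\<phi> i)) \<and>
     (\<forall>i. elements_mat (\<phi> (Suc i)) \<subseteq> graded_maximal_ideal)"

text \<open>
  The regularity is the largest \<open>j - i\<close> such that \<open>S(-j)\<close> is a summand of the \<open>i\<close>-th module of the
  minimal graded free resolution. That resolution exists and is unique up to isomorphism, so
  the supremum over all of them is the supremum over any single one. The zero ideal has
  regularity \<open>-\<infinity>\<close>.
\<close>

definition regularity :: "('n::finite, 'k::field) mpoly set \<Rightarrow> ereal" where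
  "regularity I = Sup {ereal (real_of_int (j - int i)) | i j.
     \<exists>d \<phi>. minimal_graded_free_resolution I d \<phi> \<and> j \<in> set (d i)}"


subsection \<open>Graphs\<close>

text \<open>A finite simple graph on the vertex set \<open>UNIV :: 'n set\<close> is given by its set of edges.\<close>

definition simple_graph :: "'n::finite set set \<Rightarrow> bool" where
  "simple_graph E \<longleftrightarrow> (\<forall>e\<in>E. card e = 2)"

definition edge_ideal :: "'n::finite set set \<Rightarrow> ('n, 'k::field) mpoly set" where
  "edge_ideal E = ideal_gen {X u * X v | u v. {u, v} \<in> E}"

definition stable :: "'n set set \<Rightarrow> 'n set \<Rightarrow> bool" where
  "stable E T \<longleftrightarrow> (\<forall>e. e \<subseteq> T \<and> card e = 2 \<longrightarrow> e \<notin> E)"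

definition stable_complex :: "'n set set \<Rightarrow> 'n set set" where
  "stable_complex E = {T. stable E T}"

definition complex_dim :: "'n::finite set set \<Rightarrow> int" where
  "complex_dim \<Delta> = int (Max (card ` \<Delta>)) - 1"

end

theory Submission
  imports Defs "HOL-Library.Countable" "HOL-Library.Multiset_Order"
begin

text \<open>
  The degrees in a minimal free resolution are detected by Koszul homology: if \<open>S(-j)\<close> is a
  summand of the \<open>i\<close>-th module in the resolution of \<open>J\<close>, then the \<open>i\<close>-th Koszul homology
  \<open>H\<^sub>i(J)\<close> of \<open>J\<close> with respect to the variables is nonzero in degree \<open>j\<close>
  (\<open>resolution_degree_bound\<close>). For a monomial ideal this homology splits into multidegrees, and
  in multidegree \<open>a\<close> it is the homology of a finite simplicial complex with coefficients in the
  field (\<open>koszul_cycle_in_mon_ideal\<close>). So it is enough to show that \<open>H\<^sub>p(I(G)\<^sup>s)\<close> vanishes in every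
  multidegree \<open>a\<close> with \<open>|a| \<ge> p + 2s + r\<close>, where \<open>r = c + 1\<close> is the largest size of a stable set;
  this is \<open>acyclic_at_power\<close>.

  The vanishing is proved by induction on \<open>s\<close>. Between \<open>I(G)\<^bsup>s+1\<^esup>\<close> and \<open>I(G)\<^sup>s\<close> the products of \<open>s\<close>
  edges are adjoined one at a time, those with the larger multiset of edges first. Adjoining a
  product \<open>m\<close> to an ideal \<open>L\<close> adds a copy of \<open>S/(L:m)\<close> shifted by \<open>2s\<close>, so the long exact
  sequence reduces everything to the regularity of \<open>S/(L:m)\<close>, which has to be at most \<open>r\<close>. Two
  facts give this bound.

  \<^item> The ideal \<open>L:m\<close> is generated in degrees at most two (\<open>colon_power_above_quadratic\<close>). The
  quadrics in \<open>I(G)\<^bsup>s+1\<^esup>:m\<close> come from paths that alternate between the edges of \<open>m\<close> and those of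
  a product of \<open>s + 1\<close> edges (\<open>colon_power_quadratic\<close>), and the order in which the products are
  adjoined is what keeps the rest of \<open>L:m\<close> in degrees at most two.

  \<^item> If a monomial ideal \<open>Q\<close> is generated in degrees at most two, then the regularity of \<open>S/Q\<close> is
  at most the largest size of a set of variables that has no element and no product of two distinct
  elements in \<open>Q\<close> (\<open>acyclic_at_quadratic\<close>). Since \<open>L:m\<close> contains \<open>I(G)\<close>, such a set is stable.
\<close>

section \<open>The Koszul complex\<close>

text \<open>
  The exterior basis needs a linear order on the variables; the one induced by \<open>to_nat\<close> is as
  good as any other.
\<close>

definition koszul_sign :: "'n::finite \<Rightarrow> 'n set \<Rightarrow> 'r::comm_ring_1" where
  "koszul_sign v T = (-1) ^ card {u \<in> T. to_nat u < to_nat v}"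

lemma koszul_sign_square [simp]: "koszul_sign v T * koszul_sign v T = (1 :: 'r::comm_ring_1)"
  by (simp add: koszul_sign_def flip: power_mult_distrib)

lemma koszul_sign_cancel [simp]: "koszul_sign v T * (koszul_sign v T * x) = (x :: 'r::comm_ring_1)"
  by (simp flip: mult.assoc)

lemma koszul_sign_insert:
  assumes "w \<notin> T"
  shows "koszul_sign v (insert w T) =
    (if to_nat w < to_nat v then - koszul_sign v T else koszul_sign v T :: 'r::comm_ring_1)"
proof (cases "to_nat w < to_nat v")
  case True
  then have "{u \<in> insert w T. to_nat u < to_nat v} = insert w {u \<in> T. to_nat u < to_nat v}"
    by auto
  with True assms show ?thesis by (simp add: koszul_sign_def)
next
  case False
  then have "{u \<in> insert w T. to_nat u < to_nat v} = {u \<in> T. to_nat u < to_nat v}"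
    by auto
  with False show ?thesis by (simp add: koszul_sign_def)
qed

lemma koszul_sign_exchange:
  assumes "v \<noteq> w" "v \<notin> T" "w \<notin> T"
  shows "koszul_sign v T * koszul_sign w (insert v T) = - (koszul_sign w T * koszul_sign v (insert w T) :: 'r::comm_ring_1)"
proof -
  have "to_nat v \<noteq> to_nat w"
    using assms(1) by simp
  then show ?thesis
    using assms by (auto simp: koszul_sign_insert not_less)
qed

text \<open>
  A chain of the Koszul complex on a sequence \<open>c\<close> is given by its coefficients, indexed by the
  sets of variables that form the exterior basis. The choice \<open>c = X\<close> gives the complex over the
  polynomial ring, the choice \<open>c = 1\<close> its strand in a single multidegree, which is a simplicial
  chain complex.
\<close>

definition koszul :: "('n::finite \<Rightarrow> 'r::comm_ring_1) \<Rightarrow> ('n set \<Rightarrow> 'r) \<Rightarrow> 'n set \<Rightarrow> 'r" where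
  "koszul c f T = (\<Sum>v\<in>-T. koszul_sign v T * c v * f (insert v T))"

lemma koszul_diff: "koszul c (\<lambda>T. f T - g T) T = koszul c f T - koszul c g T"
  by (simp add: koszul_def algebra_simps sum_subtractf)

lemma koszul_add: "koszul c (\<lambda>T. f T + g T) T = koszul c f T + koszul c g T"
  by (simp add: koszul_def algebra_simps sum.distrib)

lemma koszul_sum: "koszul c (\<lambda>T. \<Sum>i\<in>I. f i T) T = (\<Sum>i\<in>I. koszul c (f i) T)"
  by (simp add: koszul_def sum_distrib_left sum.swap[of _ _ I])

lemma koszul_scale: "koszul c (\<lambda>T. a * f T) T = a * koszul c f T"
  by (simp add: koszul_def sum_distrib_left algebra_simps)

lemma koszul_cong:
  assumes "\<And>v. v \<notin> T \<Longrightarrow> f (insert v T) = g (insert v T)"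
  shows "koszul c f T = koszul c g T"
  unfolding koszul_def by (rule sum.cong) (use assms in auto)

lemma koszul_eq_0:
  assumes "\<And>v. v \<notin> T \<Longrightarrow> f (insert v T) = 0"
  shows "koszul c f T = 0"
  using assms by (simp add: koszul_def)

lemma koszul_nonzeroD:
  assumes "koszul c f T \<noteq> 0"
  obtains v where "v \<notin> T" "f (insert v T) \<noteq> 0"
  using assms koszul_eq_0 by blast

text \<open>
  The terms of the double sum cancel in pairs, because removing two elements in the two possible
  orders gives opposite signs (\<open>koszul_sign_exchange\<close>).
\<close>

lemma koszul_koszul:
  fixes c :: "'n::finite \<Rightarrow> 'r::comm_ring_1"
  shows "koszul c (koszul c f) T = 0"
proof -
  define P where "P = {(v, w). v \<notin> T \<and> w \<notin> T \<and> v \<noteq> w}"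
  define F where "F = (\<lambda>(v, w). koszul_sign v T * c v * (koszul_sign w (insert v T) * c w * f (insert w (insert v T))))"
  define N where "N = {(v, w) \<in> P. to_nat v < to_nat w}"
  have eq: "koszul c (koszul c f) T = sum F P"
  proof -
    have "koszul c (koszul c f) T = (\<Sum>v\<in>-T. \<Sum>w\<in>-insert v T. F (v, w))"
      by (simp add: koszul_def F_def sum_distrib_left)
    also have "\<dots> = sum F (Sigma (-T) (\<lambda>v. -insert v T))"
      by (subst sum.Sigma) auto
    also have "Sigma (-T) (\<lambda>v. -insert v T) = P"
      by (auto simp: P_def)
    finally show ?thesis .
  qed
  have swap: "F (prod.swap x) = - F x" if "x \<in> P" for x
  proof -
    obtain v w where x: "x = (v, w)" by (cases x)
    have vw: "v \<noteq> w" "v \<notin> T" "w \<notin> T" using that by (auto simp: P_def x)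
    have "F (w, v) = (koszul_sign w T * koszul_sign v (insert w T)) * (c v * c w * f (insert v (insert w T)))"
      by (simp add: F_def algebra_simps)
    also have "\<dots> = - (koszul_sign v T * koszul_sign w (insert v T)) * (c v * c w * f (insert v (insert w T)))"
      using koszul_sign_exchange[OF vw, where 'r='r] by simp
    also have "\<dots> = - F (v, w)"
      by (simp add: F_def algebra_simps insert_commute)
    finally show ?thesis by (simp add: x)
  qed
  have "P = N \<union> prod.swap ` N"
  proof -
    have "x \<in> N \<union> prod.swap ` N" if xP: "x \<in> P" for x
    proof -
      obtain v w where x: "x = (v, w)" by (cases x)
      with xP have vw: "v \<noteq> w" by (simp add: P_def)
      then have "to_nat v \<noteq> to_nat w" by simp
      then consider "to_nat v < to_nat w" | "to_nat w < to_nat v" by linarith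
      then show ?thesis
      proof cases
        case 1 then show ?thesis using xP x by (simp add: N_def)
      next
        case 2
        then have "(w, v) \<in> N" using xP x by (auto simp: N_def P_def)
        then show ?thesis using x by force
      qed
    qed
    then show ?thesis by (auto simp: N_def P_def)
  qed
  moreover have "N \<inter> prod.swap ` N = {}"
    by (auto simp: N_def)
  ultimately have "sum F P = sum F N + sum F (prod.swap ` N)"
    by (simp add: sum.union_disjoint)
  also have "sum F (prod.swap ` N) = (\<Sum>x\<in>N. F (prod.swap x))"
    by (subst sum.reindex) (auto simp: inj_on_def)
  also have "\<dots> = - sum F N"
    using swap by (subst sum_negf[symmetric], intro sum.cong) (auto simp: N_def)
  finally show ?thesis using eq by simp
qed

section \<open>Simplicial homology relative to a subcomplex\<close>

definition set_convex :: "'a set set \<Rightarrow> bool" where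
  "set_convex D \<longleftrightarrow> (\<forall>A\<in>D. \<forall>C\<in>D. \<forall>B. A \<subseteq> B \<and> B \<subseteq> C \<longrightarrow> B \<in> D)"

lemma set_convexD: "set_convex D \<Longrightarrow> A \<in> D \<Longrightarrow> C \<in> D \<Longrightarrow> A \<subseteq> B \<Longrightarrow> B \<subseteq> C \<Longrightarrow> B \<in> D"
  unfolding set_convex_def by blast

definition chain :: "nat \<Rightarrow> 'n set set \<Rightarrow> ('n set \<Rightarrow> 'k::zero) \<Rightarrow> bool" where
  "chain p D f \<longleftrightarrow> (\<forall>T. f T \<noteq> 0 \<longrightarrow> T \<in> D \<and> card T = p)"

abbreviation boundary :: "('n::finite set \<Rightarrow> 'k::comm_ring_1) \<Rightarrow> 'n set \<Rightarrow> 'k" where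
  "boundary \<equiv> koszul (\<lambda>_. 1)"

text \<open>
  A convex family \<open>D\<close> is a difference of two simplicial complexes. Its chains form the relative
  chain complex of that pair, so the boundary is read only on members of \<open>D\<close>. Recording \<open>D\<close>
  instead of the pair builds in excision: pairs with the same difference have the same homology.
  Degrees count vertices, not dimensions, as in the Koszul complex.
\<close>

definition acyclic_family :: "'k::comm_ring_1 itself \<Rightarrow> nat \<Rightarrow> 'n::finite set set \<Rightarrow> bool" where
  "acyclic_family K p D \<longleftrightarrow> (\<forall>f :: 'n set \<Rightarrow> 'k. chain p D f \<longrightarrow> (\<forall>T\<in>D. boundary f T = 0) \<longrightarrow>
     (\<exists>g. chain (Suc p) D g \<and> (\<forall>T\<in>D. boundary g T = f T)))"

lemma acyclic_familyD:
  assumes "acyclic_family TYPE('k::comm_ring_1) p D"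
    and "chain p D (f :: 'n::finite set \<Rightarrow> 'k)" "\<And>T. T \<in> D \<Longrightarrow> boundary f T = 0"
  obtains g where "chain (Suc p) D g" "\<And>T. T \<in> D \<Longrightarrow> boundary g T = f T"
  using assms unfolding acyclic_family_def by blast

lemma chain_boundary_card:
  assumes "chain (Suc p) D g" "boundary g T \<noteq> 0"
  shows "card T = p"
proof -
  obtain v where "v \<notin> T" "g (insert v T) \<noteq> 0"
    using assms(2) by (rule koszul_nonzeroD)
  then show ?thesis using assms(1) by (auto simp: chain_def)
qed

text \<open>
  By convexity, a set outside \<open>D\<close> that contains a member of \<open>D\<close> lies below no member of \<open>D\<close>.
  Hence truncating a boundary to \<open>D\<close> does not change its own boundary on \<open>D\<close>, and the truncated
  boundary still squares to zero.
\<close>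

lemma boundary_eq_0_outside:
  assumes "set_convex D" "chain p D g" "T \<in> D" "T \<subseteq> U" "U \<notin> D"
  shows "boundary g U = 0"
proof (rule koszul_eq_0)
  fix v show "g (insert v U) = 0"
    using assms set_convexD[OF assms(1,3), of "insert v U" U] unfolding chain_def by auto
qed

text \<open>
  The exact part \<open>H\<^sub>p(D2) \<rightarrow> H\<^sub>p(D) \<rightarrow> H\<^sub>p(D1)\<close> of the long exact sequence for the subcomplex \<open>D2\<close>.
\<close>

lemma acyclic_family_extension:
  assumes conv: "set_convex D" and D: "D = D1 \<union> D2" "D1 \<inter> D2 = {}"
    and closed: "\<And>T U. U \<in> D2 \<Longrightarrow> T \<in> D \<Longrightarrow> T \<subseteq> U \<Longrightarrow> T \<in> D2"
    and 1: "acyclic_family TYPE('k::comm_ring_1) p D1" and 2: "acyclic_family TYPE('k) p D2"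
  shows "acyclic_family TYPE('k) p (D :: 'n::finite set set)"
  unfolding acyclic_family_def
proof (intro allI impI)
  fix f :: "'n set \<Rightarrow> 'k"
  assume f: "chain p D f" and cycle: "\<forall>T\<in>D. boundary f T = 0"
  define f1 where "f1 T = (if T \<in> D1 then f T else 0)" for T
  have closed': "insert v T \<notin> D2" if "T \<in> D1" for v T
    using closed[of "insert v T" T] that D by auto
  have "boundary f1 T = boundary f T" if "T \<in> D1" for T
  proof (rule koszul_cong)
    fix v
    show "f1 (insert v T) = f (insert v T)"
      using closed'[OF that, of v] f D by (auto simp: f1_def chain_def)
  qed
  moreover have "chain p D1 f1"
    using f by (auto simp: chain_def f1_def)
  ultimately obtain g1 where g1: "chain (Suc p) D1 g1" "\<And>T. T \<in> D1 \<Longrightarrow> boundary g1 T = f1 T"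
    using acyclic_familyD[OF 1, of f1] cycle D by auto
  have g1D: "chain (Suc p) D g1"
    using g1(1) D by (auto simp: chain_def)
  define f2 where "f2 T = (if T \<in> D2 then f T - boundary g1 T else 0)" for T
  have "boundary f2 T = boundary (\<lambda>T. f T - boundary g1 T) T" if "T \<in> D2" for T
  proof (rule koszul_cong)
    fix v
    consider "insert v T \<in> D1" | "insert v T \<in> D2" | "insert v T \<notin> D" using D by auto
    then show "f2 (insert v T) = f (insert v T) - boundary g1 (insert v T)"
    proof cases
      case 1
      then show ?thesis using D g1(2) by (auto simp: f2_def f1_def)
    next
      case 2
      then show ?thesis by (simp add: f2_def)
    next
      case 3
      then show ?thesis using boundary_eq_0_outside[OF conv g1D, of T "insert v T", OF _ subset_insertI] that D f
        by (auto simp: f2_def chain_def)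
    qed
  qed
  then have "boundary f2 T = 0" if "T \<in> D2" for T
    using that cycle D by (simp add: koszul_diff koszul_koszul)
  moreover have "chain p D2 f2"
    unfolding chain_def
  proof (intro allI impI)
    fix T assume "f2 T \<noteq> 0"
    then have "T \<in> D2" "f T \<noteq> 0 \<or> boundary g1 T \<noteq> 0" by (auto simp: f2_def split: if_splits)
    then show "T \<in> D2 \<and> card T = p"
      using f chain_boundary_card[OF g1(1)] by (auto simp: chain_def)
  qed
  ultimately obtain g2 where g2: "chain (Suc p) D2 g2" "\<And>T. T \<in> D2 \<Longrightarrow> boundary g2 T = f2 T"
    using acyclic_familyD[OF 2] by metis
  have "boundary (\<lambda>T. g1 T + g2 T) T = f T" if "T \<in> D" for T
  proof (cases "T \<in> D1")
    case True
    then have "boundary g2 T = 0"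
      using closed' g2(1) by (intro koszul_eq_0) (auto simp: chain_def)
    then show ?thesis using True g1(2) by (simp add: koszul_add f1_def)
  next
    case False
    then show ?thesis using that D g2(2) by (simp add: koszul_add f2_def)
  qed
  moreover have "chain (Suc p) D (\<lambda>T. g1 T + g2 T)"
    using g1(1) g2(1) D unfolding chain_def by (metis UnI1 UnI2 add.left_neutral add.right_neutral)
  ultimately show "\<exists>g. chain (Suc p) D g \<and> (\<forall>T\<in>D. boundary g T = f T)"
    by blast
qed

text \<open>
  The exact part \<open>H\<^bsub>p+1\<^esub>(D) \<rightarrow> H\<^sub>p(B) \<rightarrow> H\<^sub>p(A)\<close> of the long exact sequence for the subcomplex \<open>B\<close>.
\<close>

lemma acyclic_family_closed_part:
  assumes conv: "set_convex A" and A: "A = B \<union> D" "B \<inter> D = {}"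
    and closed: "\<And>T U. U \<in> B \<Longrightarrow> T \<in> A \<Longrightarrow> T \<subseteq> U \<Longrightarrow> T \<in> B"
    and 1: "acyclic_family TYPE('k::comm_ring_1) p A" and 2: "acyclic_family TYPE('k) (Suc p) D"
  shows "acyclic_family TYPE('k) p (B :: 'n::finite set set)"
  unfolding acyclic_family_def
proof (intro allI impI)
  fix f :: "'n set \<Rightarrow> 'k"
  assume f: "chain p B f" and cycle: "\<forall>T\<in>B. boundary f T = 0"
  have closed': "insert v T \<notin> B" if "T \<in> D" for v T
    using closed[of "insert v T" T] that A by auto
  have "boundary f T = 0" if "T \<in> A" for T
  proof (cases "T \<in> B")
    case False
    then show ?thesis using that A closed' f by (intro koszul_eq_0) (auto simp: chain_def)
  qed (use cycle in auto)
  moreover have "chain p A f" using f A by (auto simp: chain_def)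
  ultimately obtain g where g: "chain (Suc p) A g" "\<And>T. T \<in> A \<Longrightarrow> boundary g T = f T"
    using acyclic_familyD[OF 1] by metis
  define g1 where "g1 T = (if T \<in> D then g T else 0)" for T
  have "boundary g1 T = 0" if "T \<in> D" for T
  proof -
    have "boundary g1 T = boundary g T"
    proof (rule koszul_cong)
      fix v
      show "g1 (insert v T) = g (insert v T)"
        using closed'[OF that, of v] g(1) A by (auto simp: g1_def chain_def)
    qed
    also have "\<dots> = 0" using g(2) that A f by (auto simp: chain_def)
    finally show ?thesis .
  qed
  moreover have "chain (Suc p) D g1" using g(1) by (auto simp: chain_def g1_def)
  ultimately obtain h where h: "chain (Suc (Suc p)) D h" "\<And>T. T \<in> D \<Longrightarrow> boundary h T = g1 T"
    using acyclic_familyD[OF 2] by metis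
  have hA: "chain (Suc (Suc p)) A h" using h(1) A by (auto simp: chain_def)
  define g2 where "g2 T = (if T \<in> B then g T - boundary h T else 0)" for T
  have "boundary g2 T = f T" if "T \<in> B" for T
  proof -
    have "boundary g2 T = boundary (\<lambda>T. g T - boundary h T) T"
    proof (rule koszul_cong)
      fix v
      consider "insert v T \<in> B" | "insert v T \<in> D" | "insert v T \<notin> A" using A by auto
      then show "g2 (insert v T) = g (insert v T) - boundary h (insert v T)"
      proof cases
        case 2
        then show ?thesis using h(2) A by (auto simp: g2_def g1_def)
      next
        case 3
        then show ?thesis using boundary_eq_0_outside[OF conv hA, of T "insert v T", OF _ subset_insertI] that A g(1)
          by (auto simp: g2_def chain_def)
      qed (simp add: g2_def)
    qed
    then show ?thesis using g(2) that A by (simp add: koszul_diff koszul_koszul)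
  qed
  moreover have "chain (Suc p) B g2"
    unfolding chain_def
  proof (intro allI impI)
    fix T assume "g2 T \<noteq> 0"
    then have "T \<in> B" "g T \<noteq> 0 \<or> boundary h T \<noteq> 0" by (auto simp: g2_def split: if_splits)
    then show "T \<in> B \<and> card T = Suc p"
      using g(1) chain_boundary_card[OF h(1)] by (auto simp: chain_def)
  qed
  ultimately show "\<exists>g. chain (Suc p) B g \<and> (\<forall>T\<in>B. boundary g T = f T)"
    by blast
qed

text \<open>
  Joining with the apex \<open>v\<close> is a contracting homotopy.
\<close>

lemma acyclic_family_cone:
  assumes cone: "\<And>T. v \<notin> T \<Longrightarrow> insert v T \<in> D \<longleftrightarrow> T \<in> D"
  shows "acyclic_family TYPE('k::comm_ring_1) p (D :: 'n::finite set set)"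
  unfolding acyclic_family_def
proof (intro allI impI)
  fix f :: "'n set \<Rightarrow> 'k"
  assume f: "chain p D f" and cycle: "\<forall>T\<in>D. boundary f T = 0"
  define g where "g T = (if v \<in> T then koszul_sign v (T - {v}) * f (T - {v}) else 0)" for T
  have cone': "T \<in> D" if "v \<in> T" "T - {v} \<in> D" for T
    using cone[of "T - {v}"] that by (simp add: insert_absorb)
  have "chain (Suc p) D g"
    unfolding chain_def
  proof (intro allI impI)
    fix T assume "g T \<noteq> 0"
    then have "v \<in> T" "f (T - {v}) \<noteq> 0"
      by (auto simp: g_def split: if_splits)
    then show "T \<in> D \<and> card T = Suc p"
      using f cone' card_Suc_Diff1[of T v] by (auto simp: chain_def)
  qed
  moreover have "boundary g T = f T" if "T \<in> D" for T
  proof (cases "v \<in> T")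
    case False
    have "boundary g T = (\<Sum>w\<in>-T. if w = v then f T else 0)"
      unfolding koszul_def by (rule sum.cong) (use False in \<open>auto simp: g_def\<close>)
    then show ?thesis using False by simp
  next
    case True
    define U where "U = T - {v}"
    have T: "T = insert v U" "v \<notin> U" using True by (auto simp: U_def)
    have "boundary f U = 0" using cycle cone T that by blast
    moreover have "boundary f U = (\<Sum>w\<in>insert v (-T). koszul_sign w U * f (insert w U))"
      unfolding koszul_def by (rule sum.cong) (use T in auto)
    moreover have "\<dots> = koszul_sign v U * f T + (\<Sum>w\<in>-T. koszul_sign w U * f (insert w U))"
      by (subst sum.insert) (auto simp: T)
    ultimately have "koszul_sign v U * f T + (\<Sum>w\<in>-T. koszul_sign w U * f (insert w U)) = 0"
      by simp
    then have "koszul_sign v U * (koszul_sign v U * f T + (\<Sum>w\<in>-T. koszul_sign w U * f (insert w U))) = 0"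
      by simp
    then have "f T + (\<Sum>w\<in>-T. koszul_sign v U * koszul_sign w U * f (insert w U)) = 0"
      by (simp add: distrib_left sum_distrib_left mult.assoc)
    moreover have "boundary g T = - (\<Sum>w\<in>-T. koszul_sign v U * koszul_sign w U * f (insert w U))"
      unfolding koszul_def sum_negf[symmetric]
    proof (rule sum.cong[OF refl])
      fix w assume "w \<in> - T"
      then have w: "w \<noteq> v" "w \<notin> U" using T by auto
      have "insert w T - {v} = insert w U" using w T by auto
      then have g: "g (insert w T) = koszul_sign v (insert w U) * f (insert w U)"
        using True by (simp add: g_def)
      have "koszul_sign w T * koszul_sign v (insert w U) = - (koszul_sign v U * koszul_sign w U :: 'k)"
      proof (cases "to_nat w < to_nat v")
        case True
        then show ?thesis using w T by (simp add: koszul_sign_insert mult.commute)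
      next
        case False
        then have "to_nat v < to_nat w" using w by (metis linorder_neqE_nat to_nat_split)
        then show ?thesis using w T by (simp add: koszul_sign_insert mult.commute)
      qed
      then show "koszul_sign w T * 1 * g (insert w T) = - (koszul_sign v U * koszul_sign w U * f (insert w U))"
        by (simp add: g flip: mult.assoc)
    qed
    ultimately show ?thesis by (simp add: add_eq_0_iff)
  qed
  ultimately show "\<exists>g. chain (Suc p) D g \<and> (\<forall>T\<in>D. boundary g T = f T)"
    by blast
qed

section \<open>Strands of monomial ideals\<close>

text \<open>
  Monomials are finite multisets of variables: products are sums and divisibility is \<open>\<subseteq>#\<close>.
  The upward closed sets are the sets of monomials of monomial ideals.
\<close>

definition upset :: "'n multiset set \<Rightarrow> bool" where
  "upset U \<longleftrightarrow> (\<forall>x\<in>U. \<forall>y. x \<subseteq># y \<longrightarrow> y \<in> U)"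

lemma upsetD: "upset U \<Longrightarrow> x \<in> U \<Longrightarrow> x \<subseteq># y \<Longrightarrow> y \<in> U"
  by (auto simp: upset_def)

text \<open>
  The Koszul basis elements of multidegree \<open>a\<close> with coefficients in the span of \<open>D\<close>. If \<open>D\<close> is a
  monomial ideal, this is its upper Koszul complex at \<open>a\<close>. The other sets \<open>D\<close> of interest are the
  complement of an ideal \<open>Q\<close>, which stands for \<open>S/Q\<close>, and differences of two ideals, which stand
  for their quotients.
\<close>

definition faces :: "'n::finite multiset set \<Rightarrow> 'n multiset \<Rightarrow> 'n set set" where
  "faces D a = {T. mset_set T \<subseteq># a \<and> a - mset_set T \<in> D}"

definition mset_convex :: "'n multiset set \<Rightarrow> bool" where
  "mset_convex D \<longleftrightarrow> (\<forall>x\<in>D. \<forall>z\<in>D. \<forall>y. x \<subseteq># y \<and> y \<subseteq># z \<longrightarrow> y \<in> D)"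

lemma mset_convex_upset: "upset U \<Longrightarrow> mset_convex U"
  by (auto simp: upset_def mset_convex_def)

lemma mset_convex_Compl_upset: "upset U \<Longrightarrow> mset_convex (-U)"
  by (auto simp: upset_def mset_convex_def)

lemma mset_set_mono: "A \<subseteq> B \<Longrightarrow> mset_set A \<subseteq># mset_set (B :: 'n::finite set)"
  by (simp add: subset_imp_msubset_mset_set)

lemma diff_mset_set_antimono: "A \<subseteq> B \<Longrightarrow> a - mset_set B \<subseteq># a - mset_set (A :: 'n::finite set)"
  using mset_set_mono[of A B] by (auto simp: subseteq_mset_def intro: diff_le_mono2)

lemma set_convex_faces:
  assumes "mset_convex D"
  shows "set_convex (faces D a)"
  unfolding set_convex_def
proof (intro ballI allI impI)
  fix A C B assume AC: "A \<in> faces D a" "C \<in> faces D a" "A \<subseteq> B \<and> B \<subseteq> C"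
  then have "mset_set B \<subseteq># a"
    using mset_set_mono[of B C] unfolding faces_def by (blast intro: subset_mset.order_trans)
  moreover have "a - mset_set B \<in> D"
    using AC assms diff_mset_set_antimono[of B C a] diff_mset_set_antimono[of A B a]
    unfolding faces_def mset_convex_def by blast
  ultimately show "B \<in> faces D a" by (simp add: faces_def)
qed

abbreviation acyclic_at :: "'k::comm_ring_1 itself \<Rightarrow> nat \<Rightarrow> 'n::finite multiset set \<Rightarrow> 'n multiset \<Rightarrow> bool" where
  "acyclic_at K p D a \<equiv> acyclic_family K p (faces D a)"

text \<open>
  For ideals \<open>C \<subseteq> B \<subseteq> A\<close> this is the sequence \<open>0 \<rightarrow> B/C \<rightarrow> A/C \<rightarrow> A/B \<rightarrow> 0\<close>, with \<open>D1\<close> for \<open>A/B\<close>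
  and \<open>D2\<close> for \<open>B/C\<close>.
\<close>

lemma acyclic_at_extension:
  assumes "mset_convex (D1 \<union> D2)" "D1 \<inter> D2 = {}"
    and up: "\<And>x y. x \<in> D2 \<Longrightarrow> y \<in> D1 \<union> D2 \<Longrightarrow> x \<subseteq># y \<Longrightarrow> y \<in> D2"
    and "acyclic_at TYPE('k::comm_ring_1) p D1 a" "acyclic_at TYPE('k) p D2 a"
  shows "acyclic_at TYPE('k) p (D1 \<union> D2) a"
proof (rule acyclic_family_extension[OF set_convex_faces[OF assms(1)] _ _ _ assms(4,5)])
  show "faces (D1 \<union> D2) a = faces D1 a \<union> faces D2 a"
    by (auto simp: faces_def)
  show "faces D1 a \<inter> faces D2 a = {}"
    using assms(2) by (auto simp: faces_def)
  show "T \<in> faces D2 a" if "U \<in> faces D2 a" "T \<in> faces (D1 \<union> D2) a" "T \<subseteq> U" for T U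
    using that up[of "a - mset_set U" "a - mset_set T"] diff_mset_set_antimono[of T U a]
    by (auto simp: faces_def)
qed

text \<open>
  For ideals \<open>B \<subseteq> A\<close> this is the sequence \<open>0 \<rightarrow> B \<rightarrow> A \<rightarrow> A/B \<rightarrow> 0\<close>, with \<open>D\<close> for \<open>A/B\<close>.
\<close>

lemma acyclic_at_closed_part:
  assumes "mset_convex (B \<union> D)" "B \<inter> D = {}"
    and up: "\<And>x y. x \<in> B \<Longrightarrow> y \<in> B \<union> D \<Longrightarrow> x \<subseteq># y \<Longrightarrow> y \<in> B"
    and "acyclic_at TYPE('k::comm_ring_1) p (B \<union> D) a" "acyclic_at TYPE('k) (Suc p) D a"
  shows "acyclic_at TYPE('k) p B a"
proof (rule acyclic_family_closed_part[OF set_convex_faces[OF assms(1)] _ _ _ assms(4,5)])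
  show "faces (B \<union> D) a = faces B a \<union> faces D a"
    by (auto simp: faces_def)
  show "faces B a \<inter> faces D a = {}"
    using assms(2) by (auto simp: faces_def)
  show "T \<in> faces B a" if "U \<in> faces B a" "T \<in> faces (B \<union> D) a" "T \<subseteq> U" for T U
    using that up[of "a - mset_set U" "a - mset_set T"] diff_mset_set_antimono[of T U a]
    by (auto simp: faces_def)
qed

lemma acyclic_family_empty: "acyclic_family TYPE('k::comm_ring_1) p {}"
  by (auto simp: acyclic_family_def chain_def intro!: exI[of _ "\<lambda>_. 0"])

text \<open>
  Multiplication by \<open>u\<close> shifts the multidegree by \<open>u\<close> and keeps the homological degree.
\<close>

lemma acyclic_at_shift:
  assumes "u \<subseteq># a \<Longrightarrow> acyclic_at TYPE('k::comm_ring_1) p D (a - u)"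
  shows "acyclic_at TYPE('k) p {w. u \<subseteq># w \<and> w - u \<in> D} a"
proof (cases "u \<subseteq># a")
  case True
  have "mset_set T \<subseteq># a \<and> u \<subseteq># a - mset_set T \<longleftrightarrow> mset_set T \<subseteq># a - u" for T :: "'a set"
    unfolding subseteq_mset_def all_conj_distrib[symmetric] count_diff
  proof (rule iff_allI)
    fix x
    have "count u x \<le> count a x" using True by (simp add: subseteq_mset_def)
    then show "(count (mset_set T) x \<le> count a x \<and> count u x \<le> count a x - count (mset_set T) x) \<longleftrightarrow>
        count (mset_set T) x \<le> count a x - count u x" by linarith
  qed
  moreover have "a - mset_set T - u = a - u - mset_set T" for T :: "'a set"
    by (simp add: add.commute)
  ultimately have "faces {w. u \<subseteq># w \<and> w - u \<in> D} a = faces D (a - u)"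
    unfolding faces_def by auto
  then show ?thesis using assms True by simp
next
  case False
  then have "faces {w. u \<subseteq># w \<and> w - u \<in> D} a = {}"
    unfolding faces_def by (auto dest: subset_mset.dual_order.trans[OF diff_subset_eq_self])
  then show ?thesis by (simp add: acyclic_family_empty)
qed

text \<open>
  Lowering the exponent of \<open>x\<close> from its maximal value \<open>a\<^sub>x\<close> by one amounts to adding \<open>x\<close> to the
  face, so if this has no effect on membership in \<open>D\<close>, the faces form a cone with apex \<open>x\<close>.
\<close>

lemma acyclic_at_cone:
  assumes x: "x \<in># a" and
    stable: "\<And>w. w \<subseteq># a \<Longrightarrow> count w x = count a x \<Longrightarrow> w - {#x#} \<in> D \<longleftrightarrow> w \<in> D"
  shows "acyclic_at TYPE('k::comm_ring_1) p D a"
proof (rule acyclic_family_cone[of x])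
  fix T :: "'a set"
  assume xT: "x \<notin> T"
  have ins: "mset_set (insert x T) = add_mset x (mset_set T)"
    using xT by simp
  have "mset_set (insert x T) \<subseteq># a \<longleftrightarrow> mset_set T \<subseteq># a"
    unfolding ins using x xT by (auto simp: subseteq_mset_def count_mset_set' Suc_le_eq)
  moreover have "a - mset_set (insert x T) = (a - mset_set T) - {#x#}"
    unfolding ins by simp
  moreover have "count (a - mset_set T) x = count a x"
    using xT by simp
  ultimately show "insert x T \<in> faces D a \<longleftrightarrow> T \<in> faces D a"
    using stable[of "a - mset_set T"] by (simp add: faces_def)
qed

section \<open>Monomial ideals generated by quadrics\<close>

definition independent :: "'n multiset set \<Rightarrow> 'n set \<Rightarrow> bool" where
  "independent Q T \<longleftrightarrow> (\<forall>u\<in>T. {#u#} \<notin> Q) \<and> (\<forall>u\<in>T. \<forall>v\<in>T. u \<noteq> v \<longrightarrow> {#u, v#} \<notin> Q)"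

definition quadric_generated :: "'n multiset set \<Rightarrow> bool" where
  "quadric_generated Q \<longleftrightarrow> (\<forall>w\<in>Q. \<exists>q\<in>Q. q \<subseteq># w \<and> size q \<le> 2)"

text \<open>
  The short exact sequence \<open>0 \<rightarrow> S/(Q:x)(-1) \<rightarrow> S/Q \<rightarrow> S/(Q,x) \<rightarrow> 0\<close> for a variable \<open>x\<close> outside \<open>Q\<close>
  shows that the regularity of \<open>S/Q\<close> is at most the size \<open>r\<close> of a largest independent set: a set
  that is independent for \<open>Q:x\<close> stays independent for \<open>Q\<close> when \<open>x\<close> is added, so the bound for
  \<open>Q:x\<close> drops by one, which makes up for the shift. The argument runs inside one multidegree \<open>a\<close>
  and counts only independent sets in the support of \<open>a\<close>. In this way a variable that has become
  free in \<open>Q:x\<close> is not counted again.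
\<close>

lemma acyclic_at_quadratic:
  assumes "upset Q" "quadric_generated Q"
    and "\<And>T. T \<subseteq> set_mset a \<Longrightarrow> independent Q T \<Longrightarrow> card T \<le> r"
    and "size a > p + r"
  shows "acyclic_at TYPE('k::comm_ring_1) p (-Q) (a :: 'n::finite multiset)"
  using assms
proof (induction "size a + card {x \<in> set_mset a. {#x#} \<notin> Q}" arbitrary: a Q r rule: less_induct)
  case less
  note Q = less.prems(1,2) and ind = less.prems(3) and size = less.prems(4)
  show ?case
  proof (cases "\<exists>x. x \<in># a \<and> {#x#} \<notin> Q")
    case False
    \<comment> \<open>If every variable of the support lies in Q, the only possible face is the whole
       support, and
       it has the wrong size.\<close>
    have "\<not> (T \<in> faces (-Q) a \<and> card T = p)" for T
    proof
      assume T: "T \<in> faces (-Q) a \<and> card T = p"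
      have "x \<notin># a - mset_set T" for x
        using T False upsetD[OF Q(1), of "{#x#}" "a - mset_set T"]
        by (auto simp: faces_def dest: in_diffD)
      then have "a - mset_set T = {#}"
        by (metis multiset_nonemptyE)
      then have "a = mset_set T"
        using T by (metis (no_types, lifting) add.right_neutral faces_def mem_Collect_eq subset_mset.add_diff_inverse)
      then show False using T size by simp
    qed
    then have "f = (\<lambda>_. 0)" if "chain p (faces (-Q) a) f" for f :: "'n set \<Rightarrow> 'k"
      using that by (auto simp: chain_def)
    then show ?thesis
      unfolding acyclic_family_def by (auto simp: chain_def intro!: exI[of _ "\<lambda>_. 0"])
  next
    case True
    then obtain x where x: "x \<in># a" "{#x#} \<notin> Q" by blast
    show ?thesis
    proof (cases "count a x \<ge> 2 \<and> {#x, x#} \<notin> Q")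
      case True
      \<comment> \<open>No generator involves x twice, so the strand is a cone.\<close>
      show ?thesis
      proof (rule acyclic_at_cone[OF x(1)])
        fix w assume w: "w \<subseteq># a" "count w x = count a x"
        have "w - {#x#} \<in> Q" if wQ: "w \<in> Q"
        proof -
          obtain q where q: "q \<in> Q" "q \<subseteq># w" "size q \<le> 2"
            using Q(2) wQ unfolding quadric_generated_def by blast
          have "count q x \<le> 1"
          proof (rule ccontr)
            assume "\<not> count q x \<le> 1"
            then have sub: "{#x, x#} \<subseteq># q" by (auto simp: subseteq_mset_def)
            then obtain z where z: "q = {#x, x#} + z" by (metis subset_mset.le_iff_add)
            then have "z = {#}" using q(3) by simp
            then have "q = {#x, x#}" using z by simp
            then show False using q(1) True by simp
          qed
          then have "q \<subseteq># w - {#x#}"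
            using q(2) w(2) True by (force simp: subseteq_mset_def)
          then show ?thesis using q(1) Q(1) upsetD by blast
        qed
        moreover have "w \<in> Q" if "w - {#x#} \<in> Q"
          using that upsetD[OF Q(1)] diff_subset_eq_self by blast
        ultimately show "w - {#x#} \<in> - Q \<longleftrightarrow> w \<in> - Q" by auto
      qed
    next
      case noncone: False
      define C where "C = {w. add_mset x w \<in> Q}"
      define P where "P = Q \<union> {w. x \<in># w}"
      have QC: "Q \<subseteq> C"
        using upsetD[OF Q(1), of _ "add_mset x _"] by (auto simp: C_def)
      have upC: "upset C" and upP: "upset P"
        using Q(1) unfolding upset_def C_def P_def by (auto dest: mset_subset_eqD)
      have "quadric_generated P"
        unfolding quadric_generated_def
      proof
        fix w assume w: "w \<in> P"
        show "\<exists>q\<in>P. q \<subseteq># w \<and> size q \<le> 2"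
        proof (cases "w \<in> Q")
          case True
          then show ?thesis using Q(2) by (auto simp: quadric_generated_def P_def)
        next
          case False
          then have "x \<in># w" using w by (simp add: P_def)
          then show ?thesis by (intro bexI[of _ "{#x#}"]) (auto simp: P_def)
        qed
      qed
      have "quadric_generated C"
        unfolding quadric_generated_def
      proof
        fix w assume "w \<in> C"
        then obtain q where q: "q \<in> Q" "q \<subseteq># add_mset x w" "size q \<le> 2"
          using Q(2) by (auto simp: quadric_generated_def C_def)
        have "q - {#x#} \<in> C"
          using upsetD[OF Q(1) q(1), of "add_mset x (q - {#x#})"] by (auto simp: C_def subseteq_mset_def)
        moreover have "q - {#x#} \<subseteq># w"
          using q(2) by (simp add: subset_eq_diff_conv)
        moreover have "size (q - {#x#}) \<le> 2"
          using q(3) by (meson diff_subset_eq_self le_trans size_mset_mono)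
        ultimately show "\<exists>q\<in>C. q \<subseteq># w \<and> size q \<le> 2" by blast
      qed
      have "independent Q {x}" using x(2) by (simp add: independent_def)
      then have "1 \<le> r" using ind[of "{x}"] x(1) by simp
      have colon: "acyclic_at TYPE('k) p (-C) (a - {#x#})"
      proof (rule less.hyps[OF _ upC \<open>quadric_generated C\<close>])
        have "card {y \<in> set_mset (a - {#x#}). {#y#} \<notin> C} \<le> card {y \<in> set_mset a. {#y#} \<notin> Q}"
          by (rule card_mono) (use QC in \<open>auto dest: in_diffD\<close>)
        moreover have "Suc (size (a - {#x#})) = size a"
          using x(1) by (simp add: size_Suc_Diff1)
        ultimately show "size (a - {#x#}) + card {y \<in> set_mset (a - {#x#}). {#y#} \<notin> C}
            < size a + card {x \<in> set_mset a. {#x#} \<notin> Q}" by linarith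
        show "p + (r - 1) < size (a - {#x#})"
          using \<open>Suc (size (a - {#x#})) = size a\<close> size \<open>1 \<le> r\<close> by linarith
        fix T assume T: "T \<subseteq> set_mset (a - {#x#})" "independent C T"
        \<comment> \<open>If x still divides the reduced multidegree, then its square lies in Q, as the cone
           case is excluded; so x lies in Q:x and belongs to no independent set.\<close>
        have "x \<notin> T"
        proof
          assume xT: "x \<in> T"
          then have "x \<in># a - {#x#}" using T by blast
          then have "count a x \<ge> 2" by (simp add: in_diff_count)
          then have "{#x#} \<in> C" using noncone by (simp add: C_def)
          then show False using T(2) xT by (auto simp: independent_def)
        qed
        moreover have "independent Q (insert x T)"
          using T(2) x(2) QC by (auto simp: independent_def C_def add_mset_commute)
        moreover have "insert x T \<subseteq> set_mset a"
          using T(1) x(1) by (auto dest: in_diffD)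
        ultimately show "card T \<le> r - 1"
          using ind[of "insert x T"] by (simp add: finite_subset)
      qed
      have sum: "acyclic_at TYPE('k) p (-P) a"
      proof (rule less.hyps[OF _ upP \<open>quadric_generated P\<close> _ size])
        have "{y \<in> set_mset a. {#y#} \<notin> P} \<subset> {y \<in> set_mset a. {#y#} \<notin> Q}"
          using x by (auto simp: P_def)
        then show "size a + card {x \<in> set_mset a. {#x#} \<notin> P}
            < size a + card {x \<in> set_mset a. {#x#} \<notin> Q}"
          by (simp add: psubset_card_mono)
        show "card T \<le> r" if "T \<subseteq> set_mset a" "independent P T" for T
          using ind[OF that(1)] that(2) by (auto simp: independent_def P_def)
      qed
      define M where "M = {w. {#x#} \<subseteq># w \<and> w - {#x#} \<in> - C}"
      have Q_split: "-Q = -P \<union> M"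
        by (auto simp: P_def M_def C_def)
      have "acyclic_at TYPE('k) p (-P \<union> M) a"
      proof (rule acyclic_at_extension)
        show "mset_convex (-P \<union> M)"
          using mset_convex_Compl_upset[OF Q(1)] by (simp add: Q_split)
        show "-P \<inter> M = {}" by (auto simp: P_def M_def)
        show "y \<in> M" if "z \<in> M" "y \<in> - P \<union> M" "z \<subseteq># y" for z y
          using that unfolding M_def P_def by (auto dest: mset_subset_eqD)
        show "acyclic_at TYPE('k) p M a"
          unfolding M_def using colon by (rule acyclic_at_shift)
      qed (rule sum)
      then show ?thesis by (simp add: Q_split)
    qed
  qed
qed

section \<open>Colon ideals of powers of edge ideals\<close>

text \<open>
  Edges are numbered, so that the linear order on the numbers orders the multisets of edges. A
  product of edges may arise from several multisets; keeping the multiset rather than the product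
  avoids the choice of a preferred factorization.
\<close>

definition edge_prod :: "(nat \<Rightarrow> 'n multiset) \<Rightarrow> nat multiset \<Rightarrow> 'n multiset" where
  "edge_prod e B = \<Sum>\<^sub># (image_mset e B)"

text \<open>
  The monomials in the \<open>s\<close>-th power of the ideal generated by the edges.
\<close>

definition edge_power :: "(nat \<Rightarrow> 'n multiset) \<Rightarrow> nat set \<Rightarrow> nat \<Rightarrow> 'n multiset set" where
  "edge_power e I s = {M. \<exists>B\<in>multisets_of_size I s. edge_prod e B \<subseteq># M}"

lemma edge_powerI: "B \<in> multisets_of_size I s \<Longrightarrow> edge_prod e B \<subseteq># M \<Longrightarrow> M \<in> edge_power e I s"
  by (auto simp: edge_power_def)

lemma edge_prod_simps [simp]:
  "edge_prod e {#} = {#}"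
  "edge_prod e (add_mset i B) = e i + edge_prod e B"
  "edge_prod e (A + B) = edge_prod e A + edge_prod e B"
  by (simp_all add: edge_prod_def)

lemma upset_edge_power: "upset (edge_power e I s)"
  unfolding upset_def edge_power_def by (blast intro: subset_mset.order_trans)

lemma edge_power_add_edge:
  assumes "M \<in> edge_power e I s" "i \<in> I" "e i + M \<subseteq># N"
  shows "N \<in> edge_power e I (Suc s)"
proof -
  obtain B where "B \<in> multisets_of_size I s" "edge_prod e B \<subseteq># M"
    using assms(1) by (auto simp: edge_power_def)
  then show ?thesis
    using assms(2) by (intro edge_powerI[of "add_mset i B" I "Suc s"])
      (auto simp: multisets_of_size_def intro: subset_mset.order_trans[OF subset_mset.add_left_mono assms(3)])
qed

lemma in_edge_prod: "b \<in># edge_prod e B \<longleftrightarrow> (\<exists>i\<in>#B. b \<in># e i)"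
  by (auto simp: edge_prod_def)

lemma multisets_of_size_empty_set: "finite (multisets_of_size {} n)"
  by (cases n) auto

lemma finite_multisets_of_size: "finite A \<Longrightarrow> finite (multisets_of_size A n)"
  by (induction A arbitrary: n rule: finite_induct)
     (auto simp: multisets_of_size_insert multisets_of_size_empty_set)

text \<open>
  The ideal reached in the passage from the power \<open>s + 1\<close> to the power \<open>s\<close> just before the
  product of \<open>R\<close> is adjoined.
\<close>

definition edge_power_above :: "(nat \<Rightarrow> 'n multiset) \<Rightarrow> nat set \<Rightarrow> nat \<Rightarrow> nat multiset \<Rightarrow> 'n multiset set" where
  "edge_power_above e I s R = edge_power e I (Suc s) \<union> {M. \<exists>B\<in>multisets_of_size I s. R < B \<and> edge_prod e B \<subseteq># M}"

context
  fixes e :: "nat \<Rightarrow> 'n::finite multiset" and I :: "nat set"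
  assumes edge_size: "\<And>i. i \<in> I \<Longrightarrow> size (e i) = 2"
begin

lemma size_edge_prod: "B \<in> multisets_of_size I s \<Longrightarrow> size (edge_prod e B) = 2 * s"
  by (induction B arbitrary: s) (auto simp: multisets_of_size_def edge_size)

lemma edge_split:
  assumes "i \<in> I" "a \<in># e i"
  obtains b where "e i = {#a, b#}"
proof -
  have "size (e i - {#a#}) = Suc 0"
    using assms edge_size by (simp add: size_Diff_singleton)
  then obtain b where "e i - {#a#} = {#b#}" using size_1_singleton_mset by auto
  then show thesis using that assms(2) by (metis insert_DiffM)
qed

lemma take_edge:
  assumes "B \<in> multisets_of_size I s" "a \<in># edge_prod e B"
  obtains i b B' s' where "B = add_mset i B'" "i \<in> I" "e i = {#a, b#}" "s = Suc s'"
    "B' \<in> multisets_of_size I s'" "edge_prod e B = add_mset a (add_mset b (edge_prod e B'))"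
proof -
  obtain i where i: "i \<in># B" "a \<in># e i" using assms(2) by (auto simp: in_edge_prod)
  then have "i \<in> I" using assms(1) by (auto simp: multisets_of_size_def)
  then obtain b where b: "e i = {#a, b#}" using i(2) by (rule edge_split)
  obtain B' where B': "B = add_mset i B'" using i(1) by (meson mset_add)
  show thesis
    using that[of i B' b "size B'"] B' b assms(1) \<open>i \<in> I\<close> by (auto simp: multisets_of_size_def)
qed

text \<open>
  Let \<open>B\<close> be a multiset of \<open>s + 1\<close> edges whose product divides \<open>w\<close> times the product of \<open>R\<close>.
  For reasons of degree, some edge \<open>{a, b}\<close> of \<open>B\<close> has its end \<open>a\<close> in \<open>w\<close>. If the edge does not
  divide \<open>w\<close>, its end \<open>b\<close> is covered by an edge \<open>{b, c}\<close> of \<open>R\<close>. Remove both edges and replace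
  \<open>a\<close> by \<open>c\<close> in \<open>w\<close>; by induction there is a quadric for the smaller situation. If it uses \<open>c\<close>,
  exchanging \<open>c\<close> for \<open>a\<close> gives the quadric sought. Unrolled, the induction follows an alternating
  path that starts and ends in \<open>w\<close>; its two ends are the quadric.
\<close>

lemma colon_power_quadratic:
  assumes "R \<in> multisets_of_size I s" "w + edge_prod e R \<in> edge_power e I (Suc s)"
  shows "\<exists>q. q \<subseteq># w \<and> size q = 2 \<and> q + edge_prod e R \<in> edge_power e I (Suc s)"
  using assms
proof (induction s arbitrary: R w)
  case (0 R w)
  then have R: "R = {#}" by (simp add: multisets_of_size_def)
  obtain B where B: "B \<in> multisets_of_size I (Suc 0)" "edge_prod e B \<subseteq># w"
    using 0(2) by (auto simp: edge_power_def R)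
  then have "edge_prod e B \<in> edge_power e I (Suc 0)" by (auto simp: edge_power_def)
  then show ?case using B size_edge_prod[OF B(1)] by (intro exI[of _ "edge_prod e B"]) (simp add: R)
next
  case (Suc s R w)
  obtain B where B: "B \<in> multisets_of_size I (Suc (Suc s))" "edge_prod e B \<subseteq># w + edge_prod e R"
    using Suc.prems(2) by (auto simp: edge_power_def)
  have "\<exists>a. a \<in># w \<and> a \<in># edge_prod e B"
  proof (rule ccontr)
    assume none: "\<not> ?thesis"
    have "edge_prod e B \<subseteq># edge_prod e R"
      unfolding subseteq_mset_def
    proof
      fix a
      show "count (edge_prod e B) a \<le> count (edge_prod e R) a"
      proof (cases "a \<in># w")
        case True
        then show ?thesis using none by (metis not_in_iff zero_le)
      next
        case False
        then show ?thesis using B(2) by (auto simp: subseteq_mset_def not_in_iff dest: spec[of _ a])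
      qed
    qed
    then have "size (edge_prod e B) \<le> size (edge_prod e R)" by (rule size_mset_mono)
    then show False using size_edge_prod[OF B(1)] size_edge_prod[OF Suc.prems(1)] by simp
  qed
  then obtain a where a: "a \<in># w" "a \<in># edge_prod e B" by blast
  obtain i b B' where i: "i \<in> I" "e i = {#a, b#}" "B' \<in> multisets_of_size I (Suc s)"
    "edge_prod e B = add_mset a (add_mset b (edge_prod e B'))"
    using take_edge[OF B(1) a(2)] by (metis nat.inject)
  obtain w1 where w1: "w = add_mset a w1" using a(1) by (meson mset_add)
  have eq: "add_mset b (edge_prod e B') \<subseteq># w1 + edge_prod e R"
    using B(2) by (simp add: i w1)
  show ?case
  proof (cases "b \<in># w1")
    case True
    then have "{#a, b#} \<subseteq># w" by (simp add: w1)
    moreover have "edge_prod e R \<in> edge_power e I (Suc s)" using Suc.prems(1) by (auto simp: edge_power_def)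
    then have "{#a, b#} + edge_prod e R \<in> edge_power e I (Suc (Suc s))"
      using i(1,2) by (intro edge_power_add_edge[of _ e I "Suc s" i]) auto
    ultimately show ?thesis by (intro exI[of _ "{#a, b#}"]) simp
  next
    case False
    then have "b \<in># edge_prod e R" using mset_subset_eqD[OF eq, of b] by auto
    then obtain k c R' where k: "k \<in> I" "e k = {#b, c#}" "R' \<in> multisets_of_size I s"
      "edge_prod e R = add_mset b (add_mset c (edge_prod e R'))"
      using take_edge[OF Suc.prems(1)] by (metis nat.inject)
    have "edge_prod e B' \<subseteq># add_mset c w1 + edge_prod e R'"
      using eq by (simp add: k)
    then have "add_mset c w1 + edge_prod e R' \<in> edge_power e I (Suc s)" using i(3) by (auto simp: edge_power_def)
    from Suc.IH[OF k(3) this] obtain q where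
      q: "q \<subseteq># add_mset c w1" "size q = 2" "q + edge_prod e R' \<in> edge_power e I (Suc s)" by blast
    show ?thesis
    proof (cases "c \<in># q")
      case False
      then have "q \<subseteq># w1" using q(1) by (metis diff_single_trivial subset_eq_diff_conv union_mset_add_mset_right add.right_neutral)
      then have "{#} + q \<subseteq># {#a#} + w1" by (intro subset_mset.add_mono) simp_all
      then have "q \<subseteq># w" by (simp add: w1)
      moreover have "q + edge_prod e R \<in> edge_power e I (Suc (Suc s))"
        using q(3) k by (intro edge_power_add_edge[of _ e I "Suc s" k]) auto
      ultimately show ?thesis using q(2) by blast
    next
      case True
      then obtain q' where q': "q = add_mset c q'" by (meson mset_add)
      have "add_mset a q' \<subseteq># w" using q(1) by (simp add: w1 q')
      moreover have "size (add_mset a q') = 2" using q(2) q' by simp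
      moreover have "add_mset a q' + edge_prod e R \<in> edge_power e I (Suc (Suc s))"
        using q(3) i(1,2) by (intro edge_power_add_edge[of _ e I "Suc s" i]) (auto simp: q' k(4))
      ultimately show ?thesis by blast
    qed
  qed
qed

text \<open>
  Let \<open>w\<close> times the product of \<open>R\<close> be divisible by the product of some \<open>B > R\<close>. After the common
  part \<open>C\<close> is removed, \<open>B\<close> contains an edge \<open>m\<close> that is larger than all edges left in \<open>R\<close>. So
  any multiset that consists of \<open>C\<close>, the edge \<open>m\<close> and further edges is again larger than \<open>R\<close>: it
  is enough to split off \<open>m\<close> and to leave a monomial in the right power. The ends of \<open>m = {a, b}\<close>
  come from \<open>w\<close> or from edges of \<open>R\<close>, and the number of ends taken from \<open>w\<close> separates the cases.
  If there is none and a single edge of \<open>R\<close> covers both ends, the product of \<open>R\<close> already lies in the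
  ideal. Otherwise removing \<open>m\<close> and the two edges of \<open>R\<close> that cover \<open>a\<close> and \<open>b\<close> leaves two free ends
  \<open>a'\<close> and \<open>b'\<close>, and \<open>colon_power_quadratic\<close> applies with these two added to \<open>w\<close>.
\<close>

lemma colon_power_above_quadratic:
  assumes R: "R \<in> multisets_of_size I s"
  shows "quadric_generated {w. w + edge_prod e R \<in> edge_power_above e I s R}"
  unfolding quadric_generated_def
proof
  fix w assume "w \<in> {w. w + edge_prod e R \<in> edge_power_above e I s R}"
  then consider "w + edge_prod e R \<in> edge_power e I (Suc s)"
    | B where "B \<in> multisets_of_size I s" "R < B" "edge_prod e B \<subseteq># w + edge_prod e R"
    by (auto simp: edge_power_above_def)
  then show "\<exists>q\<in>{w. w + edge_prod e R \<in> edge_power_above e I s R}. q \<subseteq># w \<and> size q \<le> 2"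
  proof cases
    case 1
    then show ?thesis
      using colon_power_quadratic[OF R 1] by (auto simp: edge_power_above_def)
  next
    case (2 B)
    have "\<exists>C J K. B = C + J \<and> R = C + K \<and> J \<noteq> {#} \<and> (\<forall>k\<in>#K. \<exists>j\<in>#J. k < j)"
      using 2(2) multp_implies_one_step[of "(<)" R B] by (simp add: less_multiset_def)
    then obtain C J K where CJK: "B = C + J" "R = C + K" "J \<noteq> {#}" "\<forall>k\<in>#K. \<exists>j\<in>#J. k < j"
      by blast
    define m where "m = Max_mset J"
    have "m \<in># J" using CJK(3) by (simp add: m_def)
    then obtain J' where J': "J = add_mset m J'" by (meson mset_add)
    have less: "k < m" if "k \<in># K" for k
      using CJK(4) that by (metis Max_ge finite_set_mset le_less_trans le_less m_def not_le)
    define t where "t = size J'"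
    have C: "C \<in> multisets_of_size I (size C)" and J'I: "J' \<in> multisets_of_size I t"
      and m: "m \<in> I" and K: "K \<in> multisets_of_size I (Suc t)" and s: "s = size C + Suc t"
      using 2(1) R by (auto simp: CJK J' multisets_of_size_def t_def)
    \<comment> \<open>The witness above R is C together with m and the edges that divide z.\<close>
    have good: "q + edge_prod e R \<in> edge_power_above e I s R"
      if q: "e m + z \<subseteq># q + edge_prod e K" "z \<in> edge_power e I t" for q z
    proof -
      obtain Y where Y: "Y \<in> multisets_of_size I t" "edge_prod e Y \<subseteq># z"
        using q(2) by (auto simp: edge_power_def)
      have "C + K < C + add_mset m Y"
        unfolding less_multiset_def by (rule one_step_implies_multp) (auto dest: less)
      moreover have "C + add_mset m Y \<in> multisets_of_size I s"
        using C Y m by (auto simp: multisets_of_size_def s)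
      moreover have "edge_prod e (C + add_mset m Y) \<subseteq># q + edge_prod e R"
      proof -
        have "e m + edge_prod e Y \<subseteq># q + edge_prod e K" using Y(2) q(1) by (meson subset_mset.add_left_mono subset_mset.order_trans)
        then have "edge_prod e C + (e m + edge_prod e Y) \<subseteq># edge_prod e C + (q + edge_prod e K)" by (rule subset_mset.add_left_mono)
        then show ?thesis by (simp add: CJK(2) ac_simps)
      qed
      ultimately show ?thesis unfolding edge_power_above_def CJK(2) by blast
    qed
    have div: "e m + edge_prod e J' \<subseteq># w + edge_prod e K"
      using 2(3) by (simp add: CJK J' ac_simps)
    have "e m \<noteq> {#}" using edge_size[OF m] by auto
    then obtain a0 where "a0 \<in># e m" by blast
    obtain a b where ab: "e m = {#a, b#}" and
      "a \<in># w \<and> b \<in># w - {#a#} \<or> a \<in># w \<and> b \<notin># w - {#a#} \<or> a \<notin># w \<and> b \<notin># w"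
    proof -
      obtain b0 where "e m = {#a0, b0#}" using edge_split[OF m \<open>a0 \<in># e m\<close>] .
      moreover from this have "e m = {#b0, a0#}" by simp
      ultimately show thesis using that[of a0 b0] that[of b0 a0] by blast
    qed
    then consider (both) "a \<in># w" "b \<in># w - {#a#}" | (one) "a \<in># w" "b \<notin># w - {#a#}"
      | (none) "a \<notin># w" "b \<notin># w" by blast
    then show ?thesis
    proof cases
      case both
      then have "{#a, b#} \<subseteq># w"
        by (metis insert_DiffM mset_subset_eq_add_mset_cancel single_subset_iff)
      moreover have "{#a, b#} + edge_prod e R \<in> edge_power e I (Suc s)"
        using R m ab by (intro edge_power_add_edge[of "edge_prod e R" e I _ m]) (auto simp: edge_power_def)
      ultimately show ?thesis by (intro bexI[of _ "{#a, b#}"]) (auto simp: edge_power_above_def)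
    next
      case one
      obtain w1 where w1: "w = add_mset a w1" using one(1) by (meson mset_add)
      have "add_mset b (edge_prod e J') \<subseteq># w1 + edge_prod e K" using div by (simp add: ab w1)
      then have "b \<in># edge_prod e K" using one(2) mset_subset_eqD[of _ _ b] by (fastforce simp: w1)
      then obtain k c K' where k: "K' \<in> multisets_of_size I t" "edge_prod e K = add_mset b (add_mset c (edge_prod e K'))"
        using take_edge[OF K] by (metis nat.inject)
      have "add_mset c (edge_prod e K') \<in> edge_power e I t" using k(1) by (intro edge_powerI[of K' I t]) auto
      then have "{#a#} + edge_prod e R \<in> edge_power_above e I s R"
        by (intro good[of "add_mset c (edge_prod e K')"]) (auto simp: ab k(2))
      then show ?thesis using one(1) by (intro bexI[of _ "{#a#}"]) auto
    next
      case none
      have "a \<in># edge_prod e K" using mset_subset_eqD[OF div, of a] none by (simp add: ab)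
      then obtain k a' K' where k: "K' \<in> multisets_of_size I t" "edge_prod e K = add_mset a (add_mset a' (edge_prod e K'))"
        using take_edge[OF K] by (metis nat.inject)
      show ?thesis
      proof (cases "b = a'")
        case True
        have "edge_prod e K' \<in> edge_power e I t" using k(1) by (auto simp: edge_power_def)
        then have "{#} + edge_prod e R \<in> edge_power_above e I s R"
          by (intro good[of "edge_prod e K'"]) (auto simp: ab k(2) True)
        then show ?thesis by (intro bexI[of _ "{#}"]) auto
      next
        case False
        have "add_mset b (edge_prod e J') \<subseteq># w + add_mset a' (edge_prod e K')" using div by (simp add: ab k(2))
        then have "b \<in># edge_prod e K'" using mset_subset_eqD[of _ _ b] none False by fastforce
        then obtain k b' K'' t' where k': "K'' \<in> multisets_of_size I t'" "t = Suc t'"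
          "edge_prod e K' = add_mset b (add_mset b' (edge_prod e K''))"
          using take_edge[OF k(1)] by metis
        have "edge_prod e J' \<subseteq># (w + {#a', b'#}) + edge_prod e K''" using div by (simp add: ab k(2) k'(3))
        then have "(w + {#a', b'#}) + edge_prod e K'' \<in> edge_power e I (Suc t')" using J'I k'(2) by (auto simp: edge_power_def)
        from colon_power_quadratic[OF k'(1) this] obtain q where
          q: "q \<subseteq># w + {#a', b'#}" "size q = 2" "q + edge_prod e K'' \<in> edge_power e I t" by (auto simp: k'(2))
        \<comment> \<open>The free ends that q uses are supplied by R, so only the part of q inside w is
           needed.\<close>
        define q' where "q' = q - {#a', b'#}"
        have "q' \<subseteq># w" using q(1) by (simp add: q'_def subset_eq_diff_conv)
        moreover have "size q' \<le> 2" using q(2) by (metis diff_subset_eq_self q'_def size_mset_mono)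
        moreover have "q' + edge_prod e R \<in> edge_power_above e I s R"
        proof (rule good[OF _ q(3)])
          have "q \<subseteq># q' + {#a', b'#}" by (metis q'_def subset_eq_diff_conv subset_mset.order_refl)
          then have "q + (edge_prod e K'' + {#a, b#}) \<subseteq># q' + {#a', b'#} + (edge_prod e K'' + {#a, b#})"
            by (rule subset_mset.add_right_mono)
          then show "e m + (q + edge_prod e K'') \<subseteq># q' + edge_prod e K"
            by (simp add: ab k(2) k'(3) ac_simps)
        qed
        ultimately show ?thesis by blast
      qed
    qed
  qed
qed

text \<open>
  The ideals between the powers \<open>s + 1\<close> and \<open>s\<close> are indexed by the sets \<open>F\<close> of multisets of \<open>s\<close>
  edges that are closed upwards, and a second induction descends from all multisets to the empty
  set. The quotient \<open>S/(L:m)(-2s)\<close> enters the homology of the smaller ideal with homological degree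
  raised by one. Its vanishing range therefore starts at \<open>p + 1 + 2s + r + 1\<close>, which is the claimed
  bound for \<open>s + 1\<close>. At \<open>s = 0\<close> the ideal is the whole ring, whose strands are cones outside
  multidegree zero; \<open>r > 0\<close> excludes that multidegree.
\<close>

lemma acyclic_at_power:
  assumes "finite I" and "0 < r"
    and ind: "\<And>T. (\<And>u v. u \<in> T \<Longrightarrow> v \<in> T \<Longrightarrow> u \<noteq> v \<Longrightarrow> {#u, v#} \<notin> e ` I) \<Longrightarrow> card T \<le> r"
  shows "size a \<ge> p + 2 * s + r \<Longrightarrow> acyclic_at TYPE('k::comm_ring_1) p (edge_power e I s) a"
proof (induction s arbitrary: a p)
  case 0
  then have "a \<noteq> {#}" using assms(2) by auto
  then obtain x where "x \<in># a" by blast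
  moreover have "w \<in> edge_power e I 0" for w by (simp add: edge_power_def)
  ultimately show ?case by (intro acyclic_at_cone) auto
next
  case (Suc s)
  let ?R = "multisets_of_size I s"
  have finR: "finite ?R" using assms(1) by (rule finite_multisets_of_size)
  define L where "L F = edge_power e I (Suc s) \<union> {M. \<exists>B\<in>F. edge_prod e B \<subseteq># M}" for F
  have upL: "upset (L F)" for F
    unfolding L_def using upset_edge_power[of e I "Suc s"] by (auto simp: upset_def intro: subset_mset.order_trans)
  have "acyclic_at TYPE('k) p (L F) a"
    if "F \<subseteq> ?R" "\<And>A B. A \<in> F \<Longrightarrow> B \<in> ?R \<Longrightarrow> A < B \<Longrightarrow> B \<in> F" "size a \<ge> p + 2 * Suc s + r" for F p
    using that
  proof (induction "card (?R - F)" arbitrary: F p)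
    case 0
    then have "F = ?R" using finR by auto
    moreover have "edge_power e I (Suc s) \<subseteq> edge_power e I s"
    proof
      fix M assume "M \<in> edge_power e I (Suc s)"
      then obtain B where B: "B \<in> multisets_of_size I (Suc s)" "edge_prod e B \<subseteq># M" by (auto simp: edge_power_def)
      then obtain i B' where "B = add_mset i B'" by (auto simp: multisets_of_size_def dest: size_eq_Suc_imp_eq_union)
      then show "M \<in> edge_power e I s" using B
        by (intro edge_powerI[of B' I s]) (auto simp: multisets_of_size_def intro: subset_mset.order_trans[of "edge_prod e B'" "e i + edge_prod e B'"])
    qed
    ultimately have "L F = edge_power e I s" by (auto simp: L_def edge_power_def)
    then show ?case using Suc.IH[of p a] 0(4) by simp
  next
    case (Suc n)
    \<comment> \<open>Adjoining the largest missing multiset keeps the index set closed upwards.\<close>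
    define R where "R = Max (?R - F)"
    have ne: "?R - F \<noteq> {}" using Suc(2) by (metis card.empty nat.distinct(1))
    then have R: "R \<in> ?R" "R \<notin> F" using Max_in[of "?R - F"] finR by (auto simp: R_def)
    have above: "B \<in> F" if "B \<in> ?R" "R < B" for B
    proof (rule ccontr)
      assume "B \<notin> F"
      then have "B \<le> R" using that(1) Max_ge[of "?R - F" B] finR by (simp add: R_def)
      then show False using that(2) by simp
    qed
    have F: "F = {B \<in> ?R. R < B}"
    proof (intro equalityI subsetI CollectI conjI)
      fix B assume B: "B \<in> F"
      then show "B \<in> ?R" using Suc.prems(1) by blast
      have "\<not> B < R" "B \<noteq> R" using Suc.prems(2)[OF B R(1)] R(2) B by auto
      then show "R < B" by simp
    qed (use above in auto)
    have "?R - F = insert R (?R - insert R F)" using R by auto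
    then have "card (?R - F) = card (insert R (?R - insert R F))" by (rule arg_cong)
    also have "\<dots> = Suc (card (?R - insert R F))"
      using finR by (intro card_insert_disjoint) auto
    finally have card: "n = card (?R - insert R F)" using Suc(2) by linarith
    have 1: "acyclic_at TYPE('k) p (L (insert R F)) a"
    proof (rule Suc.hyps(1)[OF card])
      show "insert R F \<subseteq> ?R" using R Suc.prems(1) by simp
      show "B \<in> insert R F" if "A \<in> insert R F" "B \<in> ?R" "A < B" for A B
        using that above Suc.prems(2) by auto
    qed (rule Suc.prems(3))
    have LF: "L F = edge_power_above e I s R" by (auto simp: L_def edge_power_above_def F)
    define Q where "Q = {w. w + edge_prod e R \<in> L F}"
    define D where "D = {w. edge_prod e R \<subseteq># w \<and> w - edge_prod e R \<in> - Q}"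
    have split: "L (insert R F) = L F \<union> D"
    proof -
      have "w \<in> D" if "edge_prod e R \<subseteq># w" "w \<notin> L F" for w
        using that by (simp add: D_def Q_def)
      then show ?thesis by (auto simp: L_def D_def)
    qed
    have upQ: "upset Q"
      using upL[of F] unfolding upset_def Q_def by (metis mem_Collect_eq subset_mset.add_right_mono)
    have "acyclic_at TYPE('k) (Suc p) (-Q) (a - edge_prod e R)" if "edge_prod e R \<subseteq># a"
    proof (rule acyclic_at_quadratic[OF upQ])
      show "quadric_generated Q"
        unfolding Q_def LF by (rule colon_power_above_quadratic[OF R(1)])
      show "Suc p + r < size (a - edge_prod e R)"
        using that Suc.prems(3) size_edge_prod[OF R(1)] by (simp add: size_Diff_submset)
      fix T assume T: "independent Q T"
      show "card T \<le> r"
      proof (rule ind)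
        fix u v assume uv: "u \<in> T" "v \<in> T" "u \<noteq> v"
        show "{#u, v#} \<notin> e ` I"
        proof
          assume "{#u, v#} \<in> e ` I"
          then obtain i where i: "i \<in> I" "e i = {#u, v#}" by auto
          have "{#u, v#} + edge_prod e R \<in> edge_power e I (Suc s)"
            using R i by (intro edge_power_add_edge[of "edge_prod e R" e I _ i]) (auto intro: edge_powerI)
          then have "{#u, v#} \<in> Q" by (simp add: Q_def L_def)
          then show False using T uv by (auto simp: independent_def)
        qed
      qed
    qed
    then have 2: "acyclic_at TYPE('k) (Suc p) D a"
      unfolding D_def by (rule acyclic_at_shift)
    show ?case
    proof (rule acyclic_at_closed_part[OF _ _ _ _ 2])
      show "mset_convex (L F \<union> D)" using mset_convex_upset[OF upL] by (simp flip: split)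
      show "L F \<inter> D = {}" by (auto simp: D_def Q_def)
      show "y \<in> L F" if "x \<in> L F" "x \<subseteq># y" for x y
        using upsetD[OF upL] that by blast
      show "acyclic_at TYPE('k) p (L F \<union> D) a" using 1 by (simp flip: split)
    qed
  qed
  from this[of "{}" p] show ?case using Suc.prems by (simp add: L_def)
qed

end

section \<open>Multigraded decomposition of the polynomial Koszul complex\<close>

definition mon :: "'n::finite multiset \<Rightarrow> 'n monomial" where
  "mon M = Abs_poly_mapping (count M)"

definition exponents :: "'n::finite monomial \<Rightarrow> 'n multiset" where
  "exponents m = Abs_multiset (Poly_Mapping.lookup m)"

lemma lookup_mon [simp]: "Poly_Mapping.lookup (mon M) = count M"
  by (simp add: mon_def)

lemma count_exponents [simp]: "count (exponents m) = Poly_Mapping.lookup m"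
  by (simp add: exponents_def count_Abs_multiset)

lemma exponents_mon [simp]: "exponents (mon M) = M"
  by (simp add: multiset_eq_iff)

lemma mon_exponents [simp]: "mon (exponents m) = m"
  by (simp add: poly_mapping_eq_iff)

lemma mon_eq_iff [simp]: "mon M = mon N \<longleftrightarrow> M = N"
  by (metis exponents_mon)

lemma mon_eq_iff_exponents: "mon M = m \<longleftrightarrow> M = exponents m"
  by auto

lemma mon_add [simp]: "mon (M + N) = mon M + mon N"
  by (simp add: poly_mapping_eq_iff lookup_add fun_eq_iff)

lemma exponents_add [simp]: "exponents (m + n) = exponents m + exponents n"
  by (simp add: multiset_eq_iff lookup_add)

lemma exponents_zero [simp]: "exponents 0 = {#}"
  by (simp add: multiset_eq_iff)

lemma mon_single: "mon {#v#} = Poly_Mapping.single v 1"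
  by (simp add: poly_mapping_eq_iff fun_eq_iff lookup_single when_def)

lemma X_mon: "X v = Poly_Mapping.single (mon {#v#}) 1"
  by (simp add: X_def mon_single)

lemma size_exponents: "size (exponents m) = monomial_degree m"
  by (simp add: monomial_degree_def size_multiset_overloaded_eq)
     (rule sum.mono_neutral_left, auto simp: not_in_iff)

definition mon_ideal :: "'n multiset set \<Rightarrow> ('n::finite, 'k::comm_ring_1) mpoly set" where
  "mon_ideal U = {p. \<forall>m\<in>Poly_Mapping.keys p. exponents m \<in> U}"

lemma mon_ideal_0 [simp]: "0 \<in> mon_ideal U"
  by (simp add: mon_ideal_def)

lemma mon_ideal_add: "p \<in> mon_ideal U \<Longrightarrow> q \<in> mon_ideal U \<Longrightarrow> p + q \<in> mon_ideal U"
  using keys_add[of p q] by (auto simp: mon_ideal_def)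

lemma mon_ideal_sum: "(\<And>i. i \<in> A \<Longrightarrow> f i \<in> mon_ideal U) \<Longrightarrow> sum f A \<in> mon_ideal U"
  by (induction A rule: infinite_finite_induct) (auto intro: mon_ideal_add)

lemma mon_ideal_mult:
  assumes "p \<in> mon_ideal U" "q \<in> mon_ideal V" "\<And>x y. x \<in> U \<Longrightarrow> y \<in> V \<Longrightarrow> x + y \<in> W"
  shows "p * q \<in> mon_ideal W"
  using keys_mult[of p q] assms by (fastforce simp: mon_ideal_def)

lemma mon_ideal_mult_left:
  assumes "upset U" "q \<in> mon_ideal U"
  shows "p * q \<in> mon_ideal U"
proof (rule mon_ideal_mult[OF _ assms(2), of p UNIV])
  show "x + y \<in> U" if "y \<in> U" for x y using upsetD[OF assms(1) that] by simp
qed (simp add: mon_ideal_def)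

lemma mon_ideal_single: "Poly_Mapping.single m c \<in> mon_ideal U \<longleftrightarrow> c = 0 \<or> exponents m \<in> U"
  by (auto simp: mon_ideal_def)

lemma single_sum: "Poly_Mapping.single m (sum f A) = (\<Sum>i\<in>A. Poly_Mapping.single m (f i))"
  by (induction A rule: infinite_finite_induct) (auto simp: single_add)

lemma poly_mapping_sum_single: "p = (\<Sum>m\<in>Poly_Mapping.keys p. Poly_Mapping.single m (Poly_Mapping.lookup p m))"
  by (rule poly_mapping_eqI) (simp add: lookup_sum lookup_single when_def in_keys_iff)

lemma koszul_sign_mult_single:
  "koszul_sign v T * Poly_Mapping.single m (c :: 'k::comm_ring_1) =
    Poly_Mapping.single (m :: 'n::finite monomial) (koszul_sign v T * c)"
  by (cases "even (card {u \<in> T. to_nat u < to_nat v})") (simp_all add: koszul_sign_def single_uminus)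

text \<open>
  The strand of multidegree \<open>a\<close> as a subcomplex of the polynomial Koszul complex, and the
  projection onto it.
\<close>

definition embed :: "'n multiset \<Rightarrow> ('n set \<Rightarrow> 'k) \<Rightarrow> 'n set \<Rightarrow> ('n::finite, 'k::comm_ring_1) mpoly" where
  "embed a h T = (if mset_set T \<subseteq># a then Poly_Mapping.single (mon (a - mset_set T)) (h T) else 0)"

definition piece :: "'n multiset \<Rightarrow> ('n set \<Rightarrow> ('n::finite, 'k::comm_ring_1) mpoly) \<Rightarrow> 'n set \<Rightarrow> 'k" where
  "piece a f T = (if mset_set T \<subseteq># a then Poly_Mapping.lookup (f T) (mon (a - mset_set T)) else 0)"

lemma koszul_embed:
  assumes h: "\<And>T. h T \<noteq> 0 \<Longrightarrow> mset_set T \<subseteq># a"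
  shows "koszul X (embed a h) T = embed a (boundary h) T"
proof -
  have summand: "koszul_sign v T * X v * embed a h (insert v T) = embed a (\<lambda>T. koszul_sign v T * h (insert v T)) T"
    if v: "v \<notin> T" for v
  proof (cases "mset_set (insert v T) \<subseteq># a")
    case True
    then have sub: "add_mset v (mset_set T) \<subseteq># a" using v by simp
    then have T: "mset_set T \<subseteq># a"
      by (metis add_mset_add_single mset_subset_eq_add_left subset_mset.order_trans)
    obtain b where b: "a = add_mset v (mset_set T) + b" using sub by (metis subset_mset.le_iff_add)
    have "X v * embed a h (insert v T) = Poly_Mapping.single (mon (a - mset_set T)) (h (insert v T))"
      using v by (simp add: embed_def X_mon mult_single b flip: mon_add)
    then show ?thesis using T by (simp add: embed_def mult.assoc koszul_sign_mult_single)
  next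
    case False
    then have "h (insert v T) = 0" using h by blast
    then show ?thesis by (simp add: embed_def)
  qed
  have "koszul X (embed a h) T = (\<Sum>v\<in>-T. embed a (\<lambda>T. koszul_sign v T * h (insert v T)) T)"
    unfolding koszul_def by (rule sum.cong) (use summand in auto)
  also have "\<dots> = embed a (boundary h) T"
    by (simp add: embed_def koszul_def single_sum)
  finally show ?thesis .
qed

definition multidegrees :: "('n set \<Rightarrow> ('n::finite, 'k::comm_ring_1) mpoly) \<Rightarrow> 'n multiset set" where
  "multidegrees f = (\<Union>T. (\<lambda>m. exponents m + mset_set T) ` Poly_Mapping.keys (f T))"

lemma multidegreesI: "m \<in> Poly_Mapping.keys (f T) \<Longrightarrow> exponents m + mset_set T \<in> multidegrees f"
  by (auto simp: multidegrees_def)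

lemma finite_multidegrees: "finite (multidegrees f)"
  by (simp add: multidegrees_def)

lemma lookup_sum_embed:
  assumes "finite D"
  shows "Poly_Mapping.lookup (\<Sum>a\<in>D. embed a (h a) T) m =
    (if exponents m + mset_set T \<in> D then h (exponents m + mset_set T) T else 0)"
proof -
  have eq: "(mset_set T \<subseteq># a \<and> mon (a - mset_set T) = m) \<longleftrightarrow> a = exponents m + mset_set T" for a
  proof
    assume "mset_set T \<subseteq># a \<and> mon (a - mset_set T) = m"
    then show "a = exponents m + mset_set T"
      using subset_mset.diff_add[of "mset_set T" a] by (metis exponents_mon)
  qed auto
  have "Poly_Mapping.lookup (embed a (h a) T) m = (if a = exponents m + mset_set T then h a T else 0)" for a
    using eq[of a] by (auto simp: embed_def lookup_single when_def)
  then show ?thesis using assms by (simp add: lookup_sum)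
qed

lemma sum_embed_piece: "f T = (\<Sum>a\<in>multidegrees f. embed a (piece a f) T)"
proof (rule poly_mapping_eqI)
  fix m
  have "Poly_Mapping.lookup (f T) m = 0" if "exponents m + mset_set T \<notin> multidegrees f"
    using that multidegreesI[of m f T] by (auto simp: in_keys_iff)
  then show "Poly_Mapping.lookup (f T) m = Poly_Mapping.lookup (\<Sum>a\<in>multidegrees f. embed a (piece a f) T) m"
    unfolding lookup_sum_embed[OF finite_multidegrees]
    by (auto simp: piece_def)
qed

text \<open>
  A polynomial cycle with values in a monomial ideal is the sum of its finitely many multigraded
  pieces. Each piece is a simplicial cycle, and the simplicial chains that bound the pieces add up
  to a polynomial chain. The bounding chain has no new multidegrees, which keeps it homogeneous.
\<close>

lemma koszul_cycle_in_mon_ideal: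
  fixes f :: "'n::finite set \<Rightarrow> ('n, 'k::comm_ring_1) mpoly"
  assumes U: "upset U" and f: "\<And>T. f T \<in> mon_ideal U" "\<And>T. f T \<noteq> 0 \<Longrightarrow> card T = p"
    and cycle: "\<And>T. koszul X f T = 0"
    and acyclic: "\<And>a. a \<in> multidegrees f \<Longrightarrow> acyclic_at TYPE('k) p U a"
  shows "\<exists>g. (\<forall>T. g T \<in> mon_ideal U) \<and> (\<forall>T. g T \<noteq> 0 \<longrightarrow> card T = Suc p) \<and>
    multidegrees g \<subseteq> multidegrees f \<and> (\<forall>T. koszul X g T = f T)"
proof -
  let ?D = "multidegrees f"
  note fin = finite_multidegrees[of f]
  have "\<exists>h. chain (Suc p) (faces U a) h \<and> (\<forall>T\<in>faces U a. boundary h T = piece a f T)"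
    if a: "a \<in> ?D" for a
  proof -
    have "chain p (faces U a) (piece a f)"
      unfolding chain_def
    proof (intro allI impI)
      fix T assume "piece a f T \<noteq> 0"
      then have T: "mset_set T \<subseteq># a" "mon (a - mset_set T) \<in> Poly_Mapping.keys (f T)"
        by (auto simp: piece_def in_keys_iff split: if_splits)
      then have "f T \<noteq> 0" by auto
      then show "T \<in> faces U a \<and> card T = p"
        using T f(1)[of T] f(2)[of T] by (auto simp: faces_def mon_ideal_def)
    qed
    moreover have "boundary (piece a f) T = 0" if T: "T \<in> faces U a" for T
    proof -
      have supp: "mset_set T \<subseteq># b" if "piece b f T \<noteq> 0" for b T
        using that by (auto simp: piece_def split: if_splits)
      have "0 = koszul X f T" using cycle by simp
      also have "\<dots> = koszul X (\<lambda>T. \<Sum>b\<in>?D. embed b (piece b f) T) T"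
        using sum_embed_piece[of f] by (intro koszul_cong) simp
      also have "\<dots> = (\<Sum>b\<in>?D. embed b (boundary (piece b f)) T)"
        by (simp add: koszul_sum koszul_embed supp)
      finally have "Poly_Mapping.lookup (\<Sum>b\<in>?D. embed b (boundary (piece b f)) T) (mon (a - mset_set T)) = 0"
        by (metis lookup_zero)
      then show ?thesis using a T
        unfolding lookup_sum_embed[OF fin] by (simp add: faces_def)
    qed
    ultimately show ?thesis using acyclic_familyD[OF acyclic[OF a]] by metis
  qed
  then obtain h where h: "\<And>a. a \<in> ?D \<Longrightarrow> chain (Suc p) (faces U a) (h a)"
    "\<And>a T. a \<in> ?D \<Longrightarrow> T \<in> faces U a \<Longrightarrow> boundary (h a) T = piece a f T"
    by metis
  define g where "g T = (\<Sum>a\<in>?D. embed a (h a) T)" for T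
  have key: "exponents m + mset_set T \<in> ?D \<and> h (exponents m + mset_set T) T \<noteq> 0"
    if "m \<in> Poly_Mapping.keys (g T)" for m T
    using that unfolding in_keys_iff g_def lookup_sum_embed[OF fin] by (auto split: if_splits)
  show ?thesis
  proof (intro exI[of _ g] conjI allI impI)
    show "g T \<in> mon_ideal U" for T
      using key[of _ T] h(1) by (fastforce simp: mon_ideal_def chain_def faces_def)
    show "card T = Suc p" if "g T \<noteq> 0" for T
    proof -
      obtain m where "m \<in> Poly_Mapping.keys (g T)" using \<open>g T \<noteq> 0\<close> by fastforce
      then show ?thesis using key h(1) by (auto simp: chain_def)
    qed
    show "multidegrees g \<subseteq> ?D"
      unfolding multidegrees_def[of g] using key by auto
    show "koszul X g T = f T" for T
    proof -
      have "koszul X g T = (\<Sum>a\<in>?D. embed a (boundary (h a)) T)"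
      proof -
        have "koszul X (embed a (h a)) T = embed a (boundary (h a)) T" if "a \<in> ?D" for a
          using h(1)[OF that] by (intro koszul_embed) (auto simp: chain_def faces_def)
        then show ?thesis unfolding g_def by (simp add: koszul_sum)
      qed
      also have "\<dots> = (\<Sum>a\<in>?D. embed a (piece a f) T)"
      proof (rule sum.cong[OF refl])
        fix a assume a: "a \<in> ?D"
        show "embed a (boundary (h a)) T = embed a (piece a f) T"
        proof (cases "mset_set T \<subseteq># a \<and> a - mset_set T \<notin> U")
          case True
          have "boundary (h a) T = 0"
          proof (rule koszul_eq_0)
            fix v
            have "insert v T \<notin> faces U a"
              using True upsetD[OF U _ diff_mset_set_antimono[OF subset_insertI]] by (auto simp: faces_def)
            then show "h a (insert v T) = 0" using h(1)[OF a] by (auto simp: chain_def)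
          qed
          moreover have "piece a f T = 0"
          proof -
            have "mon (a - mset_set T) \<notin> Poly_Mapping.keys (f T)"
              using True f(1)[of T] by (auto simp: mon_ideal_def)
            then show ?thesis by (simp add: piece_def in_keys_iff)
          qed
          ultimately show ?thesis by (simp add: embed_def)
        next
          case False
          then show ?thesis using h(2)[OF a, of T] by (auto simp: embed_def faces_def)
        qed
      qed
      also have "\<dots> = f T" using sum_embed_piece[of f T] by simp
      finally show ?thesis .
    qed
  qed
qed

section \<open>Koszul homology and minimal resolutions\<close>

lemma homogeneous_0 [simp]: "homogeneous e 0"
  by (simp add: homogeneous_def)

lemma homogeneous_add: "homogeneous e p \<Longrightarrow> homogeneous e q \<Longrightarrow> homogeneous e (p + q)"
  using keys_add[of p q] by (auto simp: homogeneous_def)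

lemma homogeneous_sum: "(\<And>i. i \<in> A \<Longrightarrow> homogeneous e (f i)) \<Longrightarrow> homogeneous e (sum f A)"
  by (induction A rule: infinite_finite_induct) (auto intro: homogeneous_add)

lemma homogeneous_mult:
  assumes "homogeneous e p" "homogeneous e' q"
  shows "homogeneous (e + e') (p * q :: ('n::finite, 'k::comm_ring_1) mpoly)"
  unfolding homogeneous_def
proof
  fix m assume "m \<in> Poly_Mapping.keys (p * q)"
  then obtain m1 m2 where "m = m1 + m2" "m1 \<in> Poly_Mapping.keys p" "m2 \<in> Poly_Mapping.keys q"
    using keys_mult[of p q] by auto
  then show "int (monomial_degree m) = e + e'"
    using assms by (auto simp: homogeneous_def monomial_degree_def lookup_add sum.distrib)
qed

lemma upset_nonempty: "upset (- {{#}})"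
  by (auto simp: upset_def)

lemma X_mult_mon_ideal: "X v * p \<in> mon_ideal (- {{#}})"
  by (rule mon_ideal_mult[of _ "- {{#}}" _ UNIV]) (auto simp: mon_ideal_def X_mon)

lemma koszul_X_mon_ideal: "koszul X f T \<in> mon_ideal (- {{#}})"
  unfolding koszul_def
  by (intro mon_ideal_sum) (auto simp: mult.assoc intro!: mon_ideal_mult_left[OF upset_nonempty] X_mult_mon_ideal)

lemma acyclic_at_UNIV:
  assumes "a \<noteq> {#}"
  shows "acyclic_at TYPE('k::comm_ring_1) p UNIV a"
proof -
  obtain x where "x \<in># a" using assms by blast
  then show ?thesis by (rule acyclic_at_cone) simp
qed

lemma homogeneous_multidegrees:
  assumes "\<And>T. homogeneous (j - int p) (f T)" "\<And>T. f T \<noteq> 0 \<Longrightarrow> card T = p" "a \<in> multidegrees f"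
  shows "int (size a) = j"
proof -
  obtain T m where a: "a = exponents m + mset_set T" "m \<in> Poly_Mapping.keys (f T)"
    using assms(3) by (auto simp: multidegrees_def)
  then have "f T \<noteq> 0" by auto
  then have "card T = p" by (rule assms(2))
  then show ?thesis using assms(1)[of T] a by (auto simp: homogeneous_def size_exponents)
qed

lemma multidegrees_homogeneous:
  assumes "\<And>a. a \<in> multidegrees f \<Longrightarrow> int (size a) = j" "\<And>T. f T \<noteq> 0 \<Longrightarrow> card T = p"
  shows "homogeneous (j - int p) (f T)"
  unfolding homogeneous_def
proof
  fix m assume m: "m \<in> Poly_Mapping.keys (f T)"
  then have "exponents m + mset_set T \<in> multidegrees f" by (auto simp: multidegrees_def)
  moreover have "f T \<noteq> 0" using m by auto
  then have "card T = p" by (rule assms(2))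
  ultimately show "int (monomial_degree m) = j - int p"
    using assms(1)[of "exponents m + mset_set T"] by (simp add: size_exponents)
qed

text \<open>
  The variables form a regular sequence, so the Koszul complex resolves \<open>K = S/(X)\<close>. The only
  obstruction is the constant coefficient in homological degree zero.
\<close>

lemma koszul_exact:
  fixes f :: "'n::finite set \<Rightarrow> ('n, 'k::comm_ring_1) mpoly"
  assumes f: "\<And>T. homogeneous (j - int p) (f T)" "\<And>T. f T \<noteq> 0 \<Longrightarrow> card T = p"
    and cycle: "\<And>T. koszul X f T = 0"
    and max: "p = 0 \<Longrightarrow> f {} \<in> mon_ideal (- {{#}})"
  obtains g where "\<And>T. homogeneous (j - int (Suc p)) (g T)" "\<And>T. g T \<noteq> 0 \<Longrightarrow> card T = Suc p"
    "\<And>T. koszul X g T = f T"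
proof -
  have acyclic: "acyclic_at TYPE('k) p UNIV a" if a: "a \<in> multidegrees f" for a
  proof (rule acyclic_at_UNIV)
    obtain T m where Tm: "a = exponents m + mset_set T" "m \<in> Poly_Mapping.keys (f T)"
      using a by (auto simp: multidegrees_def)
    then have "f T \<noteq> 0" by auto
    then have card: "card T = p" by (rule f(2))
    show "a \<noteq> {#}"
    proof
      assume "a = {#}"
      then have T: "T = {}" and m: "exponents m = {#}" using Tm(1) by (auto simp: mset_set_empty_iff)
      then show False using max Tm(2) card by (auto simp: mon_ideal_def)
    qed
  qed
  have UNIV: "upset (UNIV :: 'n multiset set)" "\<And>T. f T \<in> mon_ideal UNIV"
    by (auto simp: upset_def mon_ideal_def)
  have "\<exists>g. (\<forall>T. g T \<in> mon_ideal UNIV) \<and> (\<forall>T. g T \<noteq> 0 \<longrightarrow> card T = Suc p) \<and>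
    multidegrees g \<subseteq> multidegrees f \<and> (\<forall>T. koszul X g T = f T)"
    by (rule koszul_cycle_in_mon_ideal[OF UNIV]) (use f(2) cycle acyclic in auto)
  then obtain g where g: "\<And>T. g T \<in> mon_ideal UNIV" "\<And>T. g T \<noteq> 0 \<Longrightarrow> card T = Suc p"
    "multidegrees g \<subseteq> multidegrees f" "\<And>T. koszul X g T = f T"
    by blast
  have "homogeneous (j - int (Suc p)) (g T)" for T
  proof (rule multidegrees_homogeneous)
    show "int (size a) = j" if "a \<in> multidegrees g" for a
      using homogeneous_multidegrees[of j p f a, OF f] g(3) that by auto
  qed (rule g(2))
  then show thesis using that[of g] g(2,4) by simp
qed

text \<open>
  Vanishing of the Koszul homology of \<open>N\<close>, a graded submodule of the free module with degrees
  \<open>d\<close>, in homological degree \<open>p\<close> and degree \<open>j\<close>. This homology is \<open>Tor\<^sub>p(N, K)\<close>, hence the name.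
  The bounding chain \<open>g\<close> may have components of any degree; only the cycle is required to be
  homogeneous.
\<close>

definition tor_vanishes :: "nat \<Rightarrow> int \<Rightarrow> int list \<Rightarrow> ('n::finite, 'k::comm_ring_1) mpoly vec set \<Rightarrow> bool" where
  "tor_vanishes p j d N \<longleftrightarrow> (\<forall>f :: 'n set \<Rightarrow> ('n, 'k) mpoly vec.
     (\<forall>T. f T \<in> N) \<longrightarrow> (\<forall>T. card T \<noteq> p \<longrightarrow> f T = 0\<^sub>v (length d)) \<longrightarrow>
     (\<forall>T. \<forall>k<length d. homogeneous (j - int p - d ! k) (f T $ k)) \<longrightarrow>
     (\<forall>T. \<forall>k<length d. koszul X (\<lambda>T. f T $ k) T = 0) \<longrightarrow>
     (\<exists>g. (\<forall>T. g T \<in> N) \<and> (\<forall>T. \<forall>k<length d. koszul X (\<lambda>T. g T $ k) T = f T $ k)))"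

lemma mult_mat_vec_coord:
  assumes "A \<in> carrier_mat m n" "v \<in> carrier_vec n" "k < m"
  shows "(A *\<^sub>v v) $ k = (\<Sum>l<n. A $$ (k, l) * v $ l)"
  using assms by (auto simp: scalar_prod_def lessThan_atLeast0 intro!: sum.cong)

lemma koszul_mult_mat_vec:
  assumes A: "A \<in> carrier_mat m n" "\<And>T. v T \<in> carrier_vec n" and k: "k < m"
  shows "koszul c (\<lambda>T. (A *\<^sub>v v T) $ k) T = (\<Sum>l<n. A $$ (k, l) * koszul c (\<lambda>T. v T $ l) T)"
  by (simp add: mult_mat_vec_coord[OF A k] koszul_sum koszul_scale)

lemma koszul_vec:
  assumes "\<And>T. v T \<in> carrier_vec n" "A \<in> carrier_mat m n" "k < m"
  shows "(A *\<^sub>v vec n (\<lambda>l. koszul c (\<lambda>T. v T $ l) T)) $ k = koszul c (\<lambda>T. (A *\<^sub>v v T) $ k) T"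
  unfolding koszul_mult_mat_vec[OF assms(2,1,3)]
  by (subst mult_mat_vec_coord[OF assms(2) _ assms(3)]) simp_all

text \<open>
  Dimension shifting along \<open>0 \<rightarrow> ker A \<rightarrow> F \<rightarrow> im A \<rightarrow> 0\<close> with \<open>F\<close> free. A cycle \<open>f\<close> with values in the
  kernel bounds some \<open>w\<close> in \<open>F\<close>; for \<open>p = 0\<close> this is where minimality enters, as it places the
  kernel inside the maximal ideal times \<open>F\<close>. Then \<open>A w\<close> is a cycle in the image, hence the boundary
  of some \<open>A y\<close>, and \<open>w\<close> minus the boundary of \<open>y\<close> has values in the kernel and still bounds \<open>f\<close>.
\<close>

lemma tor_vanishes_kernel:
  fixes A :: "('n::finite, 'k::field) mpoly mat"
  assumes A: "graded_matrix d d' A"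
    and van: "tor_vanishes (Suc p) j d (mat_image A)"
    and min: "\<And>v l. p = 0 \<Longrightarrow> v \<in> mat_kernel A \<Longrightarrow> l < length d' \<Longrightarrow> v $ l \<in> mon_ideal (- {{#}})"
  shows "tor_vanishes p j d' (mat_kernel A)"
  unfolding tor_vanishes_def
proof (intro allI impI)
  fix f :: "'n set \<Rightarrow> ('n, 'k) mpoly vec"
  assume f: "\<forall>T. f T \<in> mat_kernel A" "\<forall>T. card T \<noteq> p \<longrightarrow> f T = 0\<^sub>v (length d')"
    "\<forall>T. \<forall>k<length d'. homogeneous (j - int p - d' ! k) (f T $ k)"
    "\<forall>T. \<forall>k<length d'. koszul X (\<lambda>T. f T $ k) T = 0"
  let ?m = "length d" and ?n = "length d'"
  have Ac: "A \<in> carrier_mat ?m ?n" using A by (simp add: graded_matrix_def)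
  have kerD: "v \<in> carrier_vec ?n" "A *\<^sub>v v = 0\<^sub>v ?m" if "v \<in> mat_kernel A" for v
    using that Ac by (auto simp: mat_kernel_def)
  have fc: "f T \<in> carrier_vec ?n" for T using f(1) kerD by blast
  have "\<exists>g. (\<forall>T. homogeneous (j - d' ! l - int (Suc p)) (g T)) \<and> (\<forall>T. g T \<noteq> 0 \<longrightarrow> card T = Suc p) \<and>
      (\<forall>T. koszul X g T = f T $ l)" if l: "l < ?n" for l
  proof -
    have 1: "homogeneous (j - d' ! l - int p) (f T $ l)" for T
      using f(3) l by (simp add: algebra_simps)
    have 2: "card T = p" if "f T $ l \<noteq> 0" for T
      using f(2) l that by (metis index_zero_vec(1))
    have 3: "koszul X (\<lambda>T. f T $ l) T = 0" for T using f(4) l by simp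
    have 4: "f {} $ l \<in> mon_ideal (- {{#}})" if "p = 0" using min f(1) l that by blast
    show ?thesis by (rule koszul_exact[of "j - d' ! l" p "\<lambda>T. f T $ l", OF 1 2 3 4]) auto
  qed
  then obtain w' where w': "\<And>l T. l < ?n \<Longrightarrow> homogeneous (j - d' ! l - int (Suc p)) (w' l T)"
    "\<And>l T. l < ?n \<Longrightarrow> w' l T \<noteq> 0 \<Longrightarrow> card T = Suc p"
    "\<And>l T. l < ?n \<Longrightarrow> koszul X (w' l) T = f T $ l"
    by metis
  define w where "w T = vec ?n (\<lambda>l. w' l T)" for T
  have wc: "w T \<in> carrier_vec ?n" for T by (simp add: w_def)
  have w_boundary: "koszul X (\<lambda>T. w T $ l) T = f T $ l" if "l < ?n" for l T
    using w'(3) that by (simp add: w_def)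
  have "\<exists>g. (\<forall>T. g T \<in> mat_image A) \<and> (\<forall>T. \<forall>k<?m. koszul X (\<lambda>T. g T $ k) T = (A *\<^sub>v w T) $ k)"
  proof (rule van[unfolded tor_vanishes_def, rule_format])
    show "A *\<^sub>v w T \<in> mat_image A" for T using Ac wc by (auto simp: mat_image_def)
    show "A *\<^sub>v w T = 0\<^sub>v ?m" if "card T \<noteq> Suc p" for T
    proof (rule eq_vecI)
      have "w' l T = 0" if "l < ?n" for l using w'(2)[OF that] \<open>card T \<noteq> Suc p\<close> by blast
      then show "(A *\<^sub>v w T) $ k = 0\<^sub>v ?m $ k" if "k < dim_vec (0\<^sub>v ?m)" for k
        using that mult_mat_vec_coord[OF Ac wc, of k T] by (simp add: w_def)
    qed (use Ac in simp)
    show "homogeneous (j - int (Suc p) - d ! k) ((A *\<^sub>v w T) $ k)" if "k < ?m" for T k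
      unfolding mult_mat_vec_coord[OF Ac wc that]
    proof (rule homogeneous_sum)
      fix l assume l: "l \<in> {..<?n}"
      have "homogeneous ((d' ! l - d ! k) + (j - d' ! l - int (Suc p))) (A $$ (k, l) * w T $ l)"
        using A w'(1) l that by (intro homogeneous_mult) (auto simp: graded_matrix_def w_def)
      then show "homogeneous (j - int (Suc p) - d ! k) (A $$ (k, l) * w T $ l)"
        by (simp add: algebra_simps)
    qed
    show "koszul X (\<lambda>T. (A *\<^sub>v w T) $ k) T = 0" if "k < ?m" for T k
    proof -
      have "koszul X (\<lambda>T. (A *\<^sub>v w T) $ k) T = (A *\<^sub>v f T) $ k"
        unfolding koszul_mult_mat_vec[OF Ac wc that] mult_mat_vec_coord[OF Ac fc that]
        by (rule sum.cong) (auto simp: w_boundary)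
      then show ?thesis using kerD f(1) that by simp
    qed
  qed
  then obtain u where u: "\<And>T. u T \<in> mat_image A"
    "\<And>T k. k < ?m \<Longrightarrow> koszul X (\<lambda>T. u T $ k) T = (A *\<^sub>v w T) $ k" by blast
  have "\<forall>T. \<exists>y. y \<in> carrier_vec ?n \<and> u T = A *\<^sub>v y"
    using u(1) Ac by (auto simp: mat_image_def)
  then obtain y where yc: "\<And>T. y T \<in> carrier_vec ?n" and y: "\<And>T. u T = A *\<^sub>v y T" by metis
  define b where "b T = vec ?n (\<lambda>l. koszul X (\<lambda>T. y T $ l) T)" for T
  have bc: "b T \<in> carrier_vec ?n" for T by (simp add: b_def)
  have "w T - b T \<in> mat_kernel A" for T
  proof (rule mat_kernelI[OF Ac])
    show "A *\<^sub>v (w T - b T) = 0\<^sub>v ?m"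
    proof (rule eq_vecI)
      fix k assume "k < dim_vec (0\<^sub>v ?m :: ('n, 'k) mpoly vec)"
      then have k: "k < ?m" by simp
      have "(A *\<^sub>v b T) $ k = (A *\<^sub>v w T) $ k"
        unfolding b_def koszul_vec[OF yc Ac k] using u(2)[OF k] by (simp add: y)
      then show "(A *\<^sub>v (w T - b T)) $ k = 0\<^sub>v ?m $ k"
        using Ac k by (simp add: mult_minus_distrib_mat_vec[OF Ac wc bc])
    qed (use Ac in simp)
  qed (use wc bc in simp)
  moreover have "koszul X (\<lambda>T. (w T - b T) $ l) T = f T $ l" if "l < ?n" for l T
  proof -
    have "koszul X (\<lambda>T. (w T - b T) $ l) T = koszul X (\<lambda>T. w T $ l - koszul X (\<lambda>T. y T $ l) T) T"
      using that by (simp add: b_def)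
    then show ?thesis using that by (simp add: koszul_diff koszul_koszul w_boundary)
  qed
  ultimately show "\<exists>g. (\<forall>T. g T \<in> mat_kernel A) \<and> (\<forall>T. \<forall>k<?n. koszul X (\<lambda>T. g T $ k) T = f T $ k)"
    by (intro exI[of _ "\<lambda>T. w T - b T"] conjI allI impI)
qed

text \<open>
  If \<open>H\<^sub>0\<close> of the image vanishes in degree \<open>j\<close>, the image of a basis element of degree \<open>j\<close> is a
  combination of elements of the image with coefficients in the maximal ideal. Up to the kernel, and
  hence by minimality altogether, the basis element then lies in the maximal ideal times the free
  module, which is absurd.
\<close>

lemma tor_vanishes_generators:
  fixes A :: "('n::finite, 'k::field) mpoly mat"
  assumes A: "graded_matrix d d' A"
    and van: "tor_vanishes 0 j d (mat_image A)"
    and min: "\<And>v l. v \<in> mat_kernel A \<Longrightarrow> l < length d' \<Longrightarrow> v $ l \<in> mon_ideal (- {{#}})"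
  shows "j \<notin> set d'"
proof
  let ?m = "length d" and ?n = "length d'"
  assume "j \<in> set d'"
  then obtain i where i: "i < ?n" "d' ! i = j" by (auto simp: in_set_conv_nth)
  have Ac: "A \<in> carrier_mat ?m ?n" using A by (simp add: graded_matrix_def)
  let ?e = "unit_vec ?n i :: ('n, 'k) mpoly vec"
  have Ae: "(A *\<^sub>v ?e) $ k = A $$ (k, i)" if "k < ?m" for k
    using Ac i that by simp
  define f where "f T = (if T = {} then A *\<^sub>v ?e else 0\<^sub>v ?m)" for T :: "'n set"
  have "\<exists>g. (\<forall>T. g T \<in> mat_image A) \<and> (\<forall>T. \<forall>k<?m. koszul X (\<lambda>T. g T $ k) T = f T $ k)"
  proof (rule van[unfolded tor_vanishes_def, rule_format])
    show "f T \<in> mat_image A" for T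
    proof -
      have "0\<^sub>v ?m = A *\<^sub>v 0\<^sub>v ?n" using Ac by (intro eq_vecI) auto
      then show ?thesis using Ac i by (auto simp: f_def mat_image_def)
    qed
    show "f T = 0\<^sub>v ?m" if "card T \<noteq> 0" for T using that by (auto simp: f_def)
    show "homogeneous (j - int 0 - d ! k) (f T $ k)" if "k < ?m" for T k
      using A i that Ae by (auto simp: f_def graded_matrix_def)
    show "koszul X (\<lambda>T. f T $ k) T = 0" if "k < ?m" for T k
      by (rule koszul_eq_0) (use that in \<open>simp add: f_def\<close>)
  qed
  then obtain u where u: "\<And>T. u T \<in> mat_image A"
    "\<And>T k. k < ?m \<Longrightarrow> koszul X (\<lambda>T. u T $ k) T = f T $ k" by blast
  have "\<forall>T. \<exists>y. y \<in> carrier_vec ?n \<and> u T = A *\<^sub>v y"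
    using u(1) Ac by (auto simp: mat_image_def)
  then obtain y where yc: "\<And>T. y T \<in> carrier_vec ?n" and y: "\<And>T. u T = A *\<^sub>v y T" by metis
  define b where "b = vec ?n (\<lambda>l. koszul X (\<lambda>T. y T $ l) {})"
  have bc: "b \<in> carrier_vec ?n" by (simp add: b_def)
  have "?e - b \<in> mat_kernel A"
  proof (rule mat_kernelI[OF Ac])
    show "A *\<^sub>v (?e - b) = 0\<^sub>v ?m"
    proof (rule eq_vecI)
      fix k assume "k < dim_vec (0\<^sub>v ?m :: ('n, 'k) mpoly vec)"
      then have k: "k < ?m" by simp
      have "(A *\<^sub>v b) $ k = (A *\<^sub>v ?e) $ k"
        unfolding b_def koszul_vec[OF yc Ac k] using u(2)[OF k, of "{}"] by (simp add: y f_def)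
      then show "(A *\<^sub>v (?e - b)) $ k = 0\<^sub>v ?m $ k"
        using Ac k by (simp add: mult_minus_distrib_mat_vec[OF Ac _ bc])
    qed (use Ac in simp)
  qed (use bc in simp)
  from min[OF this i(1)] have "1 - b $ i \<in> mon_ideal (- {{#}})"
    using i(1) bc by simp
  moreover have "b $ i \<in> mon_ideal (- {{#}})"
    using i(1) by (simp add: b_def koszul_X_mon_ideal)
  ultimately have "(1 - b $ i) + b $ i \<in> mon_ideal (- {{#}})"
    by (rule mon_ideal_add)
  then have "1 \<in> (mon_ideal (- {{#}}) :: ('n, 'k) mpoly set)"
    unfolding diff_add_cancel .
  moreover have "0 \<in> Poly_Mapping.keys (1 :: ('n, 'k) mpoly)"
    by simp
  ultimately have "exponents (0 :: 'n monomial) \<noteq> {#}"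
    unfolding mon_ideal_def by blast
  then show False by simp
qed

lemma tor_vanishes_mon_ideal:
  fixes U :: "'n::finite multiset set"
  assumes U: "upset U" and acyclic: "\<And>a. int (size a) = j \<Longrightarrow> acyclic_at TYPE('k::field) p U a"
  shows "tor_vanishes p j [0] {vec 1 (\<lambda>_. f) | f. f \<in> (mon_ideal U :: ('n, 'k) mpoly set)}"
  unfolding tor_vanishes_def
proof (intro allI impI)
  let ?N = "{vec 1 (\<lambda>_. f) | f. f \<in> (mon_ideal U :: ('n, 'k) mpoly set)}"
  fix f :: "'n set \<Rightarrow> ('n, 'k) mpoly vec"
  assume f: "\<forall>T. f T \<in> ?N" "\<forall>T. card T \<noteq> p \<longrightarrow> f T = 0\<^sub>v (length [0 :: int])"
    "\<forall>T. \<forall>k<length [0]. homogeneous (j - int p - [0] ! k) (f T $ k)"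
    "\<forall>T. \<forall>k<length [0 :: int]. koszul X (\<lambda>T. f T $ k) T = 0"
  define f' where "f' T = f T $ 0" for T
  have mem: "f' T \<in> mon_ideal U" for T
  proof -
    obtain q where "f T = vec 1 (\<lambda>_. q)" "q \<in> mon_ideal U" using f(1) by blast
    then show ?thesis by (simp add: f'_def)
  qed
  have card: "card T = p" if "f' T \<noteq> 0" for T
  proof (rule ccontr)
    assume "card T \<noteq> p"
    then have "f T = 0\<^sub>v (length [0 :: int])" using f(2) by blast
    then show False using that by (simp add: f'_def)
  qed
  have hom: "homogeneous (j - int p) (f' T)" for T
    using f(3) by (simp add: f'_def)
  have cycle: "koszul X f' T = 0" for T
    using f(4) by (simp add: f'_def[abs_def])
  have "\<exists>g. (\<forall>T. g T \<in> mon_ideal U) \<and> (\<forall>T. g T \<noteq> 0 \<longrightarrow> card T = Suc p) \<and>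
    multidegrees g \<subseteq> multidegrees f' \<and> (\<forall>T. koszul X g T = f' T)"
  proof (rule koszul_cycle_in_mon_ideal[OF U mem card cycle])
    show "acyclic_at TYPE('k) p U a" if "a \<in> multidegrees f'" for a
      by (rule acyclic) (rule homogeneous_multidegrees[of j p f' a, OF hom card that])
  qed
  then obtain g where g: "\<And>T. g T \<in> mon_ideal U" "\<And>T. koszul X g T = f' T" by blast
  then show "\<exists>g. (\<forall>T. g T \<in> ?N) \<and> (\<forall>T. \<forall>k<length [0 :: int]. koszul X (\<lambda>T. g T $ k) T = f T $ k)"
    by (intro exI[of _ "\<lambda>T. vec 1 (\<lambda>_. g T)"]) (auto simp: f'_def)
qed

lemma graded_maximal_ideal_subset: "graded_maximal_ideal \<subseteq> (mon_ideal (- {{#}}) :: ('n::finite, 'k::comm_ring_1) mpoly set)"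
proof -
  interpret module "(*) :: ('n, 'k) mpoly \<Rightarrow> _" by (rule module_times)
  show ?thesis
    unfolding graded_maximal_ideal_def ideal_gen_def
  proof (rule span_minimal)
    show "range X \<subseteq> (mon_ideal (- {{#}}) :: ('n, 'k) mpoly set)"
      by (auto simp: X_mon mon_ideal_def)
    show "subspace (mon_ideal (- {{#}}) :: ('n, 'k) mpoly set)"
      by (rule subspaceI) (auto intro: mon_ideal_add mon_ideal_mult_left[OF upset_nonempty])
  qed
qed

text \<open>
  Dimension shifting moves the vanishing of \<open>H\<^sub>i(J)\<close> in degree \<open>j\<close> along the resolution to the
  vanishing of \<open>H\<^sub>0\<close> of the \<open>i\<close>-th syzygy module, whose minimal generators correspond to the basis
  of the \<open>i\<close>-th free module.
\<close>

lemma resolution_degree_bound: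
  fixes J :: "('n::finite, 'k::field) mpoly set"
  assumes res: "minimal_graded_free_resolution J d \<phi>" and van: "tor_vanishes i j [0] {vec 1 (\<lambda>_. f) | f. f \<in> J}"
  shows "j \<notin> set (d i)"
proof -
  \<comment> \<open>The degrees of the target of the i-th map; the augmentation maps to S itself.\<close>
  define dd where "dd i = (case i of 0 \<Rightarrow> [0] | Suc i \<Rightarrow> d i)" for i
  have graded: "graded_matrix (dd i) (d i) (\<phi> i)" for i
    using res by (cases i) (auto simp: dd_def minimal_graded_free_resolution_def)
  have image0: "mat_image (\<phi> 0) = {vec 1 (\<lambda>_. f) | f. f \<in> J}"
    and exact: "\<And>i. mat_image (\<phi> (Suc i)) = mat_kernel (\<phi> i)"
    and entries: "\<And>i. elements_mat (\<phi> (Suc i)) \<subseteq> graded_maximal_ideal"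
    using res unfolding minimal_graded_free_resolution_def by blast+
  have min: "v $ l \<in> mon_ideal (- {{#}})" if v: "v \<in> mat_kernel (\<phi> i)" and l: "l < length (d i)" for v l i
  proof -
    have c: "\<phi> (Suc i) \<in> carrier_mat (length (d i)) (length (d (Suc i)))"
      using graded[of "Suc i"] by (simp add: graded_matrix_def dd_def)
    obtain y where y: "y \<in> carrier_vec (length (d (Suc i)))" "v = \<phi> (Suc i) *\<^sub>v y"
      using v c unfolding exact[symmetric] mat_image_def by auto
    have "\<phi> (Suc i) $$ (l, q) \<in> mon_ideal (- {{#}})" if "q < length (d (Suc i))" for q
      using entries graded_maximal_ideal_subset elements_matI[OF c l that refl] by blast
    then have "y $ q * \<phi> (Suc i) $$ (l, q) \<in> mon_ideal (- {{#}})" if "q < length (d (Suc i))" for q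
      using mon_ideal_mult_left[OF upset_nonempty] that by blast
    then show ?thesis
      unfolding y(2) mult_mat_vec_coord[OF c y(1) l]
      by (intro mon_ideal_sum) (auto simp: mult.commute)
  qed
  have "tor_vanishes (i - t) j (dd t) (mat_image (\<phi> t))" if "t \<le> i" for t
    using that
  proof (induction t)
    case 0
    then show ?case using van by (simp add: image0 dd_def)
  next
    case (Suc t)
    then have "Suc (i - Suc t) = i - t" by simp
    then have "tor_vanishes (Suc (i - Suc t)) j (dd t) (mat_image (\<phi> t))" using Suc by simp
    then have "tor_vanishes (i - Suc t) j (d t) (mat_kernel (\<phi> t))"
      by (rule tor_vanishes_kernel[OF graded]) (use min in blast)
    then show ?case by (simp add: exact dd_def)
  qed
  from this[of i] have "tor_vanishes 0 j (dd i) (mat_image (\<phi> i))" by simp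
  then show ?thesis
    by (rule tor_vanishes_generators[OF graded]) (use min in blast)
qed

section \<open>Powers of edge ideals and their regularity\<close>

lemma ideal_gen_eq_mon_ideal:
  fixes U :: "'n::finite multiset set" and B :: "('n, 'k::comm_ring_1) mpoly set"
  assumes U: "upset U" and B: "B \<subseteq> mon_ideal U"
    and gen: "\<And>M. M \<in> U \<Longrightarrow> Poly_Mapping.single (mon M) 1 \<in> ideal_gen B"
  shows "ideal_gen B = mon_ideal U"
proof -
  interpret module "(*) :: ('n, 'k) mpoly \<Rightarrow> _" by (rule module_times)
  show ?thesis
  proof
    show "ideal_gen B \<subseteq> mon_ideal U"
      unfolding ideal_gen_def
    proof (rule span_minimal[OF B])
      show "subspace (mon_ideal U :: ('n, 'k) mpoly set)"
        by (rule subspaceI) (auto intro: mon_ideal_add mon_ideal_mult_left[OF U])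
    qed
    show "mon_ideal U \<subseteq> ideal_gen B"
    proof
      fix p :: "('n, 'k) mpoly" assume p: "p \<in> mon_ideal U"
      have "Poly_Mapping.single m c \<in> ideal_gen B" if "m \<in> Poly_Mapping.keys p" for m c
      proof -
        have "Poly_Mapping.single 0 c * Poly_Mapping.single (mon (exponents m)) 1 \<in> ideal_gen B"
          using gen[of "exponents m"] p that unfolding ideal_gen_def
          by (intro span_scale) (auto simp: mon_ideal_def)
        then show ?thesis by (simp add: mult_single)
      qed
      then have "(\<Sum>m\<in>Poly_Mapping.keys p. Poly_Mapping.single m (Poly_Mapping.lookup p m)) \<in> ideal_gen B"
        unfolding ideal_gen_def by (intro span_sum) blast
      then show "p \<in> ideal_gen B" using poly_mapping_sum_single[of p] by simp
    qed
  qed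
qed

lemma ideal_power_eq_mon_ideal:
  fixes E :: "'n::finite set set" and e :: "nat \<Rightarrow> 'n multiset"
  assumes e: "{{#u, v#} | u v. {u, v} \<in> E} = e ` I" and size: "\<And>i. i \<in> I \<Longrightarrow> size (e i) = 2"
  shows "ideal_power (edge_ideal E :: ('n, 'k::field) mpoly set) s = mon_ideal (edge_power e I s)"
proof -
  define U where "U = {M. \<exists>i\<in>I. e i \<subseteq># M}"
  have upU: "upset U" by (auto simp: U_def upset_def intro: subset_mset.order_trans)
  have edge: "edge_ideal E = (mon_ideal U :: ('n, 'k) mpoly set)"
    unfolding edge_ideal_def
  proof (rule ideal_gen_eq_mon_ideal[OF upU])
    have XX: "X u * X v = (Poly_Mapping.single (mon {#u, v#}) 1 :: ('n, 'k) mpoly)" for u v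
    proof -
      have "mon {#u, v#} = mon {#u#} + mon {#v#}" by (simp flip: mon_add)
      then show ?thesis by (simp add: X_mon mult_single)
    qed
    show "{X u * X v | u v. {u, v} \<in> E} \<subseteq> (mon_ideal U :: ('n, 'k) mpoly set)"
    proof clarify
      fix u v assume "{u, v} \<in> E"
      then have "{#u, v#} \<in> e ` I" using e by blast
      then have "{#u, v#} \<in> U" by (auto simp: U_def)
      then show "X u * X v \<in> (mon_ideal U :: ('n, 'k) mpoly set)"
        by (simp only: XX mon_ideal_single exponents_mon simp_thms)
    qed
    fix M assume "M \<in> U"
    then obtain i where i: "i \<in> I" "e i \<subseteq># M" by (auto simp: U_def)
    then obtain u v where uv: "e i = {#u, v#}" "{u, v} \<in> E" using e by blast
    interpret module "(*) :: ('n, 'k) mpoly \<Rightarrow> _" by (rule module_times)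
    have "Poly_Mapping.single (mon (M - e i)) 1 * (X u * X v :: ('n, 'k) mpoly) \<in> ideal_gen {X u * X v | u v. {u, v} \<in> E}"
      unfolding ideal_gen_def using uv by (intro span_scale span_base) blast
    moreover have "Poly_Mapping.single (mon (M - e i)) 1 * (X u * X v) = (Poly_Mapping.single (mon M) 1 :: ('n, 'k) mpoly)"
      using i(2) unfolding XX uv(1)[symmetric] mult_single mon_add[symmetric] by simp
    ultimately show "(Poly_Mapping.single (mon M) 1 :: ('n, 'k) mpoly) \<in> ideal_gen {X u * X v | u v. {u, v} \<in> E}"
      by simp
  qed
  show ?thesis
  proof (induction s)
    case 0
    have "edge_power e I 0 = UNIV" by (simp add: edge_power_def edge_prod_def)
    then show ?case by (simp add: mon_ideal_def)
  next
    case (Suc s)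
    let ?B = "{f * g | f g. f \<in> edge_ideal E \<and> g \<in> ideal_power (edge_ideal E :: ('n, 'k) mpoly set) s}"
    have "ideal_gen ?B = mon_ideal (edge_power e I (Suc s))"
    proof (rule ideal_gen_eq_mon_ideal[OF upset_edge_power])
      have "f * g \<in> mon_ideal (edge_power e I (Suc s))" if "f \<in> edge_ideal E" "g \<in> mon_ideal (edge_power e I s)"
        for f g :: "('n, 'k) mpoly"
      proof (rule mon_ideal_mult[OF _ that(2)])
        show "f \<in> mon_ideal U" using that(1) edge by simp
        fix x y assume "x \<in> U" "y \<in> edge_power e I s"
        then obtain i where "i \<in> I" "e i \<subseteq># x" by (auto simp: U_def)
        then show "x + y \<in> edge_power e I (Suc s)"
          using \<open>y \<in> edge_power e I s\<close> by (intro edge_power_add_edge[of y e I s i]) auto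
      qed
      then show "?B \<subseteq> mon_ideal (edge_power e I (Suc s))" unfolding Suc.IH by blast
    next
      fix M assume "M \<in> edge_power e I (Suc s)"
      then obtain B where B: "B \<in> multisets_of_size I (Suc s)" "edge_prod e B \<subseteq># M" by (auto simp: edge_power_def)
      then obtain i B' where "B = add_mset i B'" by (auto simp: multisets_of_size_def dest: size_eq_Suc_imp_eq_union)
      with B have i: "i \<in> I" "e i + edge_prod e B' \<subseteq># M" and B': "B' \<in> multisets_of_size I s"
        by (auto simp: multisets_of_size_def edge_prod_def)
      obtain N where N: "M = (e i + N) + edge_prod e B'"
        using i(2) by (metis subset_mset.le_iff_add add.assoc add.commute)
      have "(Poly_Mapping.single (mon (e i + N)) 1 :: ('n, 'k) mpoly) \<in> edge_ideal E"
        unfolding edge mon_ideal_single using i(1) by (auto simp: U_def simp del: mon_add intro!: bexI[of _ i])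
      moreover have "(Poly_Mapping.single (mon (edge_prod e B')) 1 :: ('n, 'k) mpoly) \<in> ideal_power (edge_ideal E) s"
        unfolding Suc.IH mon_ideal_single using B' by (auto simp: edge_power_def)
      moreover have "(Poly_Mapping.single (mon M) 1 :: ('n, 'k) mpoly) =
          Poly_Mapping.single (mon (e i + N)) 1 * Poly_Mapping.single (mon (edge_prod e B')) 1"
        unfolding N mon_add[of "e i + N"] by (simp add: mult_single)
      ultimately have "(Poly_Mapping.single (mon M) 1 :: ('n, 'k) mpoly) \<in> ?B" by blast
      interpret module "(*) :: ('n, 'k) mpoly \<Rightarrow> _" by (rule module_times)
      show "(Poly_Mapping.single (mon M) 1 :: ('n, 'k) mpoly) \<in> ideal_gen ?B"
        unfolding ideal_gen_def by (rule span_base) fact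
    qed
    then show ?case by simp
  qed
qed

theorem theorem1:
  fixes E :: "'n::finite set set" and c :: int and s :: nat
  assumes "simple_graph E"
    and "c = complex_dim (stable_complex E)"
    and "s \<ge> 1"
  shows "regularity (ideal_power (edge_ideal E :: ('n, 'k::field) mpoly set) s)
           \<le> ereal (real_of_int (2 * int s + c))"
proof -
  define r where "r = Max (card ` stable_complex E)"
  have r: "c = int r - 1" using assms(2) by (simp add: complex_dim_def r_def)
  have card_le: "card T \<le> r" if "stable E T" for T
    unfolding r_def by (rule Max_ge) (use that in \<open>auto simp: stable_complex_def\<close>)
  have "stable E {v}" for v
  proof -
    have "card e \<noteq> 2" if "e \<subseteq> {v}" for e :: "'n set"
      using card_mono[OF _ that] by auto
    then show ?thesis by (auto simp: stable_def)
  qed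
  then have "0 < r" using card_le[of "{undefined}"] by simp
  have "finite {{#u, v#} | u v. {u, v} \<in> E}"
    by (rule finite_subset[of _ "(\<lambda>(u, v). {#u, v#}) ` UNIV"]) auto
  from finite_imp_nat_seg_image_inj_on[OF this] obtain n and e :: "nat \<Rightarrow> 'n multiset"
    where e: "{{#u, v#} | u v. {u, v} \<in> E} = e ` {i. i < n}"
    by (elim exE conjE)
  let ?I = "{i. i < n}"
  have size: "size (e i) = 2" if "i \<in> ?I" for i
  proof -
    have "e i \<in> {{#u, v#} | u v. {u, v} \<in> E}" unfolding e using that by blast
    then show ?thesis by auto
  qed
  have ind: "card T \<le> r" if T: "\<And>u v. u \<in> T \<Longrightarrow> v \<in> T \<Longrightarrow> u \<noteq> v \<Longrightarrow> {#u, v#} \<notin> e ` ?I" for T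
  proof (rule card_le)
    show "stable E T"
      unfolding stable_def
    proof (intro allI impI notI)
      fix f assume f: "f \<subseteq> T \<and> card f = 2" "f \<in> E"
      then obtain u v where "f = {u, v}" "u \<noteq> v" by (auto simp: card_2_iff)
      then show False using f T[of u v] e by blast
    qed
  qed
  have eq: "ideal_power (edge_ideal E :: ('n, 'k) mpoly set) s = mon_ideal (edge_power e ?I s)"
    by (rule ideal_power_eq_mon_ideal[OF e]) (rule size)
  show ?thesis
    unfolding regularity_def eq
  proof (rule Sup_least)
    fix x :: ereal
    assume "x \<in> {ereal (real_of_int (j - int i)) | i j. \<exists>d \<phi>. minimal_graded_free_resolution
      (mon_ideal (edge_power e ?I s) :: ('n, 'k) mpoly set) d \<phi> \<and> j \<in> set (d i)}"
    then obtain i j d \<phi> where x: "x = ereal (real_of_int (j - int i))" and j: "j \<in> set (d i)"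
      and res: "minimal_graded_free_resolution (mon_ideal (edge_power e ?I s) :: ('n, 'k) mpoly set) d \<phi>"
      by blast
    have "j - int i \<le> 2 * int s + c"
    proof (rule ccontr)
      assume "\<not> ?thesis"
      then have "j \<ge> int i + 2 * int s + int r" using r by linarith
      then have "acyclic_at TYPE('k) i (edge_power e ?I s) a" if "int (size a) = j" for a
        using that by (intro acyclic_at_power[of ?I e r, OF size _ \<open>0 < r\<close> ind]) auto
      then have "tor_vanishes i j [0]
          {vec 1 (\<lambda>_. f) | f. f \<in> (mon_ideal (edge_power e ?I s) :: ('n, 'k) mpoly set)}"
        by (intro tor_vanishes_mon_ideal upset_edge_power)
      then show False using resolution_degree_bound[OF res] j by blast
    qed
    then show "x \<le> ereal (real_of_int (2 * int s + c))" unfolding x by simp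
  qed
qed

end
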